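(* Let $(M,\mu)$ and $(N,\nu)$ be measure spaces with finite measures and let $K=(K_1,\dots,K_n):N\times M\to[-\infty,\infty]^n$ be measurable. Suppose $k(x,y)=|K(x,y)|=(\sum_j K_j(x,y)^2)^{1/2}$ satisfies, for some constants $A>0$, $B>0$, $\beta>1$, $\gamma>1$, $0<\beta_0\le\beta$, as $s\to+\infty$, $$m(k_1^*,s)\le A s^{-\beta}\big(1+O(\log^{-\gamma}s)\big),\qquad m(k_2^*,s)\le B s^{-\beta_0}.$$ For measurable $F=(F_1,\dots,F_n):M\to\mathbb R^n$ let $TF(x)=\int_M K(x,y)\cdot F(y)\,d\mu(y)=\int_M\sum_{j=1}^nK_j(x,y)F_j(y)\,d\mu(y)$. Then $T$ is defined on $L^{\beta'}(M)$ (vector-valued), where $\frac1\beta+\frac1{\beta'}=1$, and there exists a constant $C$ such that $$\int_N \exp\bigg[\frac{\beta_0}{A\beta}\bigg(\frac{|TF|}{\|F\|_{\beta'}}\bigg)^{\beta}\bigg]\,d\nu\le C$$ for each $F\in L^{\beta'}(M)$ (with $F\neq0$).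
   Context: For a measurable $f$ on $(M,\mu)$: $m(f,s)=\mu(\{|f|>s\})$, $f^*(t)=\inf\{s\ge0:m(f,s)\le t\}$; for functions on $(0,\infty)$ the distribution function is w.r.t. Lebesgue measure. For scalar $k$ on $N\times M$: $k_1^*(t)=\sup_{x\in N}k^*(x,\cdot)(t)$ (rearrangement in $y$ w.r.t. $\mu$) and $k_2^*(t)=\sup_{y\in M}k^*(\cdot,y)(t)$ (rearrangement in $x$ w.r.t. $\nu$). For vector-valued $F$, $|F|$ is the Euclidean norm, $F\in L^p(M)$ means $\int_M|F|^p\,d\mu<\infty$ and $\|F\|_p=(\int_M|F|^pd\mu)^{1/p}$. The $O(\log^{-\gamma}s)$ condition means $\le As^{-\beta}(1+C_0(\log s)^{-\gamma})$ for all large $s$. *)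

theory Defs
  imports "HOL-Analysis.Analysis"
begin

definition ereal_vec_norm :: "ereal ^ 'n \<Rightarrow> ereal" where
  "ereal_vec_norm v =
     (if (\<forall>j. \<bar>v $ j\<bar> \<noteq> \<infinity>)
      then ereal (sqrt (\<Sum>j\<in>UNIV. (real_of_ereal (v $ j))\<^sup>2))
      else \<infinity>)"

definition distr_fun :: "'a measure \<Rightarrow> ('a \<Rightarrow> ereal) \<Rightarrow> real \<Rightarrow> ennreal" where
  "distr_fun M f s = emeasure M {y \<in> space M. \<bar>f y\<bar> > ereal s}"

text \<open>Decreasing rearrangement f*(t) = inf{s >= 0 : m(f,s) <= t} (inf of empty set = \<infinity>).\<close>
definition rearr :: "'a measure \<Rightarrow> ('a \<Rightarrow> ereal) \<Rightarrow> real \<Rightarrow> ereal" where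
  "rearr M f t = Inf {ereal s | s. 0 \<le> s \<and> distr_fun M f s \<le> ennreal t}"

definition distr_fun_line :: "(real \<Rightarrow> ereal) \<Rightarrow> real \<Rightarrow> ennreal" where
  "distr_fun_line g s = emeasure lborel {t. 0 < t \<and> \<bar>g t\<bar> > ereal s}"

definition k1_star :: "'b measure \<Rightarrow> 'a measure \<Rightarrow> ('b \<Rightarrow> 'a \<Rightarrow> ereal) \<Rightarrow> real \<Rightarrow> ereal" where
  "k1_star N M k t = (SUP x\<in>space N. rearr M (\<lambda>y. k x y) t)"

definition k2_star :: "'b measure \<Rightarrow> 'a measure \<Rightarrow> ('b \<Rightarrow> 'a \<Rightarrow> ereal) \<Rightarrow> real \<Rightarrow> ereal" where
  "k2_star N M k t = (SUP y\<in>space M. rearr N (\<lambda>x. k x y) t)"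

definition Lp_norm :: "'a measure \<Rightarrow> real \<Rightarrow> ('a \<Rightarrow> real ^ 'n) \<Rightarrow> real" where
  "Lp_norm M p F = (integral\<^sup>L M (\<lambda>y. norm (F y) powr p)) powr (1 / p)"

definition in_Lp :: "'a measure \<Rightarrow> real \<Rightarrow> ('a \<Rightarrow> real ^ 'n) \<Rightarrow> bool" where
  "in_Lp M p F \<longleftrightarrow> F \<in> borel_measurable M \<and> (\<integral>\<^sup>+ y. ennreal (norm (F y) powr p) \<partial>M) < \<infinity>"

definition kernel_dot :: "('b \<Rightarrow> 'a \<Rightarrow> ereal ^ 'n) \<Rightarrow> ('a \<Rightarrow> real ^ 'n) \<Rightarrow> 'b \<Rightarrow> 'a \<Rightarrow> real" where
  "kernel_dot K F x y = (\<Sum>j\<in>UNIV. real_of_ereal (K x y $ j) * F y $ j)"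

definition T_op :: "'a measure \<Rightarrow> ('b \<Rightarrow> 'a \<Rightarrow> ereal ^ 'n) \<Rightarrow> ('a \<Rightarrow> real ^ 'n) \<Rightarrow> 'b \<Rightarrow> real" where
  "T_op M K F x = (LINT y|M. kernel_dot K F x y)"

end

theory Submission
  imports Defs
begin

text \<open>
  Everything reduces to two uniform bounds for $k = |K|$: $\mu\{k(x,\cdot) > s\}$ is at most
  $A s^{-\beta}(1 + C_0 \log^{-\gamma} s)$ and $\nu\{k(\cdot,y) > s\}$ is at most $B s^{-\beta_0}$.
  Let $f = |F|$ have $L^p$ norm at most one, $p = \beta'$, and put $W = |TF|^\beta / A$. At a scale $v$ the kernel
  is cut at the level $\sigma = e^{v/\beta}$. Since $\gamma > 1$, the first bound makes the $\beta$-th moment of the part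
  of $k$ between two levels at most $A (v_2 - v_1)$ plus a constant, and Hoelder's inequality handles
  this part. The part above $\sigma$ contributes $O(1)$ at some point of every set of $\nu$-measure at least
  $e^{-(\beta_0/\beta) v}$; this is a Schur test that combines both bounds.

  This alone gives the weak-type bound $\nu\{W > w\} = O(e^{-(\beta_0/\beta) w})$, which just fails to be integrable
  against $e^{(\beta_0/\beta) w}$. As in Adams' and Garsia's argument, one also splits $f$ at the level whose
  superlevel set has measure $e^{-v_1}$. With $m$ the $L^p$ mass of the upper part, near equality at $w_1$
  forces $m = O(\lambda / w_1)$, and then near equality at $w_2 > w_1$ forces $w_2 - w_1 = O(\lambda)$. Hence the set
  of integers $n$ with $\nu\{W > n\} \ge e^{-(\beta_0/\beta)(n + \lambda)}$ has $O(1 + \lambda)$ elements, which gives convergence.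
\<close>

subsection \<open>Integral inequalities\<close>

text \<open>The sharp constant \<open>\<beta>0 / (A * \<beta>)\<close> comes out because one level
  serves both hypotheses. For \<sigma> = exp(v/\<beta>) the \<beta>-th moment of k below \<sigma> is
  A \<beta> ln \<sigma> + O(1) = A v + O(1), and \<sigma>^(-\<beta>0) = exp(-(\<beta>0/\<beta>) v)
  is exactly the size of set on which the part above \<sigma> can be controlled at some point. The
  obstacle is that this exponent is critical: the terms a_n = exp((\<beta>0/\<beta>) n) \<nu>{W > n}
  are only bounded, and no estimate at a single level makes them decay. Summability has to come from
  a comparison of two levels for the same f. The main term is the lower part of f against the kernel
  below the cut, and it loses the factor (1-m)^(1/p); everything the upper part gains there is a
  bounded multiple of m^(1/p). So an f that is nearly extremal at w1 has little mass in its upper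
  part. But the kernel values between the cut for w1 and the cut for w2 contribute essentially only
  through that upper part, so f cannot be nearly extremal again at a much higher level.\<close>

lemma nn_integral_Holder:
  fixes f g :: "'a \<Rightarrow> real"
  assumes pq: "p > 1" "q > 1" "1/p + 1/q = 1"
    and [measurable]: "f \<in> borel_measurable M" "g \<in> borel_measurable M"
    and nonneg: "\<And>x. 0 \<le> f x" "\<And>x. 0 \<le> g x"
    and X: "(\<integral>\<^sup>+x. ennreal (f x powr p) \<partial>M) \<le> ennreal X" "0 \<le> X"
    and Y: "(\<integral>\<^sup>+x. ennreal (g x powr q) \<partial>M) \<le> ennreal Y" "0 \<le> Y"
  shows "(\<integral>\<^sup>+x. ennreal (f x * g x) \<partial>M) \<le> ennreal (X powr (1/p) * Y powr (1/q))"
\<comment> \<open>Normalising by the two norms divides by them, so a vanishing bound is treated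
  apart: then one factor, hence the product, is zero almost everywhere.\<close>
proof (cases "X = 0 \<or> Y = 0")
  case True
  have "AE x in M. f x * g x = 0"
  proof (cases "X = 0")
    case True
    then have "(\<integral>\<^sup>+x. ennreal (f x powr p) \<partial>M) = 0" using X by simp
    then have "AE x in M. ennreal (f x powr p) = 0" by (subst (asm) nn_integral_0_iff_AE) auto
    then show ?thesis by eventually_elim (auto simp: ennreal_eq_0_iff)
  next
    case False
    then have "(\<integral>\<^sup>+x. ennreal (g x powr q) \<partial>M) = 0" using True Y by simp
    then have "AE x in M. ennreal (g x powr q) = 0" by (subst (asm) nn_integral_0_iff_AE) auto
    then show ?thesis by eventually_elim (auto simp: ennreal_eq_0_iff)
  qed
  then have "(\<integral>\<^sup>+x. ennreal (f x * g x) \<partial>M) = 0"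
    by (subst nn_integral_0_iff_AE) (auto simp: ennreal_eq_0_iff)
  then show ?thesis by simp
next
  case False
  with X Y have XY: "X > 0" "Y > 0" by auto
  define x where "x = X powr (1/p)"
  define y where "y = Y powr (1/q)"
  have xy: "x > 0" "y > 0" "x powr p = X" "y powr q = Y"
    using XY pq by (auto simp: x_def y_def powr_powr)
  have young: "f t * g t \<le> x * y / (p * X) * f t powr p + x * y / (q * Y) * g t powr q" for t
  proof -
    have "(f t / x) * (g t / y) \<le> (f t / x) powr p / p + (g t / y) powr q / q"
      using xy nonneg pq by (intro Youngs_inequality) auto
    also have "\<dots> = f t powr p / (p * X) + g t powr q / (q * Y)"
      using xy nonneg by (simp add: powr_divide mult.commute)
    finally have "(x * y) * ((f t / x) * (g t / y)) \<le> (x * y) * (f t powr p / (p * X) + g t powr q / (q * Y))"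
      using xy by (intro mult_left_mono) auto
    then show ?thesis using xy by (simp add: field_simps)
  qed
  have c: "0 \<le> x * y / (p * X)" "0 \<le> x * y / (q * Y)" using xy XY pq by auto
  define u v where "u = x * y / (p * X)" and "v = x * y / (q * Y)"
  have "ennreal (f t * g t) \<le> ennreal u * ennreal (f t powr p) + ennreal v * ennreal (g t powr q)" for t
  proof -
    have "ennreal (f t * g t) \<le> ennreal (u * f t powr p + v * g t powr q)"
      using young by (intro ennreal_leI) (simp add: u_def v_def)
    then show ?thesis using c by (simp add: ennreal_mult ennreal_plus u_def v_def del: times_divide_eq_left)
  qed
  then have "(\<integral>\<^sup>+t. ennreal (f t * g t) \<partial>M) \<le>
      (\<integral>\<^sup>+t. ennreal (x * y / (p * X)) * ennreal (f t powr p)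
        + ennreal (x * y / (q * Y)) * ennreal (g t powr q) \<partial>M)"
    unfolding u_def v_def by (rule nn_integral_mono)
  also have "\<dots> = ennreal (x * y / (p * X)) * (\<integral>\<^sup>+t. ennreal (f t powr p) \<partial>M)
        + ennreal (x * y / (q * Y)) * (\<integral>\<^sup>+t. ennreal (g t powr q) \<partial>M)"
    by (simp add: nn_integral_add nn_integral_cmult)
  also have "\<dots> \<le> ennreal (x * y / (p * X)) * ennreal X + ennreal (x * y / (q * Y)) * ennreal Y"
    using X Y by (intro add_mono mult_left_mono) auto
  also have "\<dots> = ennreal (x * y * (1/p + 1/q))"
    using c XY pq xy by (simp flip: ennreal_mult ennreal_plus add: field_simps)
  finally show ?thesis using pq by (simp add: x_def y_def)
qed

text \<open>Where h > \<sigma>, write h^q = \<sigma>^q + the integral of q s^(q-1) over s from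
  \<sigma> to h, and exchange the integrals. Starting the integration at \<sigma> instead of 0
  leaves a boundary term, but then only tail bounds at levels s \<ge> \<sigma> are ever
  needed.\<close>

lemma nn_integral_powr_layer_cake:
  fixes h :: "'a \<Rightarrow> real"
  assumes "finite_measure Q" and h[measurable]: "h \<in> borel_measurable Q" and "q > 0" "\<sigma> > 0"
  shows "(\<integral>\<^sup>+x. ennreal (h x powr q) * indicator {x. h x > \<sigma>} x \<partial>Q) =
    ennreal (\<sigma> powr q) * emeasure Q {x\<in>space Q. h x > \<sigma>} +
    (\<integral>\<^sup>+s. ennreal (q * s powr (q - 1)) * indicator {\<sigma>..} s * emeasure Q {x\<in>space Q. h x > s} \<partial>lborel)"
proof -
  interpret Q: finite_measure Q by fact
  interpret pair_sigma_finite Q lborel by unfold_locales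
  define G where "G x s = ennreal (q * s powr (q - 1)) * indicator {\<sigma>..} s * (if s < h x then 1 else 0)"
    for x s
  have [measurable]: "case_prod G \<in> borel_measurable (Q \<Otimes>\<^sub>M lborel)"
    unfolding G_def by measurable
  have pw: "ennreal (h x powr q) * indicator {x. h x > \<sigma>} x =
      ennreal (\<sigma> powr q) * indicator {x\<in>space Q. h x > \<sigma>} x + (\<integral>\<^sup>+s. G x s \<partial>lborel)"
    if "x \<in> space Q" for x
  proof (cases "h x > \<sigma>")
    case True
    \<comment> \<open>\<open>G\<close> uses the strict condition s < h x, the fundamental theorem a
      closed interval; they differ at the single point h x.\<close>
    have "(\<integral>\<^sup>+s. G x s \<partial>lborel) =
        (\<integral>\<^sup>+s. ennreal (q * s powr (q - 1)) * indicator {\<sigma>..h x} s \<partial>lborel)"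
      using AE_lborel_singleton[of "h x"]
      by (intro nn_integral_cong_AE) (auto simp: G_def indicator_def)
    also have "\<dots> = ennreal (h x powr q - \<sigma> powr q)"
      using True \<open>\<sigma> > 0\<close> \<open>q > 0\<close>
      by (intro nn_integral_FTC_Icc[where F = "\<lambda>s. s powr q"])
         (auto intro!: derivative_eq_intros has_real_derivative_powr)
    finally show ?thesis
      using True that \<open>\<sigma> > 0\<close> \<open>q > 0\<close> by (simp flip: ennreal_plus add: powr_mono2)
  next
    case False
    then have "G x s = 0" for s by (auto simp: G_def indicator_def)
    then show ?thesis using False by simp
  qed
  have "(\<integral>\<^sup>+x. ennreal (h x powr q) * indicator {x. h x > \<sigma>} x \<partial>Q) =
      (\<integral>\<^sup>+x. ennreal (\<sigma> powr q) * indicator {x\<in>space Q. h x > \<sigma>} x + (\<integral>\<^sup>+s. G x s \<partial>lborel) \<partial>Q)"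
    using pw by (intro nn_integral_cong) auto
  also have "\<dots> = ennreal (\<sigma> powr q) * emeasure Q {x\<in>space Q. h x > \<sigma>} + (\<integral>\<^sup>+x. \<integral>\<^sup>+s. G x s \<partial>lborel \<partial>Q)"
    by (subst nn_integral_add) (auto simp: nn_integral_cmult)
  also have "(\<integral>\<^sup>+x. \<integral>\<^sup>+s. G x s \<partial>lborel \<partial>Q) = (\<integral>\<^sup>+s. \<integral>\<^sup>+x. G x s \<partial>Q \<partial>lborel)"
    by (intro Fubini'[symmetric]) measurable
  also have "\<dots> = (\<integral>\<^sup>+s. ennreal (q * s powr (q - 1)) * indicator {\<sigma>..} s * emeasure Q {x\<in>space Q. h x > s} \<partial>lborel)"
  proof (intro nn_integral_cong)
    fix s :: real
    have "(\<integral>\<^sup>+x. G x s \<partial>Q) = (\<integral>\<^sup>+x. ennreal (q * s powr (q - 1)) * indicator {\<sigma>..} s * indicator {x\<in>space Q. h x > s} x \<partial>Q)"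
      by (intro nn_integral_cong) (auto simp: G_def indicator_def)
    also have "\<dots> = ennreal (q * s powr (q - 1)) * indicator {\<sigma>..} s * emeasure Q {x\<in>space Q. h x > s}"
      by (simp add: nn_integral_cmult)
    finally show "(\<integral>\<^sup>+x. G x s \<partial>Q) = \<dots>" .
  qed
  finally show ?thesis .
qed

text \<open>A weak-type bound of order r controls moments of lower order q, with decay in the cut.
  The boundary term gives c \<sigma>^(q-r) and the integral gives c q/(r-q) \<sigma>^(q-r); their
  sum has the factor r/(r-q).\<close>

lemma nn_integral_powr_tail_le:
  fixes h :: "'a \<Rightarrow> real"
  assumes "finite_measure Q" and h[measurable]: "h \<in> borel_measurable Q"
    and "0 < q" "q < r" "1 \<le> \<sigma>" "0 \<le> c"
    and tail: "\<And>s. 1 \<le> s \<Longrightarrow> emeasure Q {x\<in>space Q. h x > s} \<le> ennreal (c * s powr (-r))"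
  shows "(\<integral>\<^sup>+x. ennreal (h x powr q) * indicator {x. h x > \<sigma>} x \<partial>Q) \<le>
    ennreal (c * r / (r - q) * \<sigma> powr (q - r))"
proof -
  have "(\<integral>\<^sup>+s. ennreal (q * s powr (q - 1)) * indicator {\<sigma>..} s * emeasure Q {x\<in>space Q. h x > s} \<partial>lborel)
     \<le> (\<integral>\<^sup>+s. ennreal (c * q * s powr (q - r - 1)) * indicator {\<sigma>..} s \<partial>lborel)"
  proof (intro nn_integral_mono)
    fix s :: real
    show "ennreal (q * s powr (q - 1)) * indicator {\<sigma>..} s * emeasure Q {x\<in>space Q. h x > s}
       \<le> ennreal (c * q * s powr (q - r - 1)) * indicator {\<sigma>..} s"
    proof (cases "\<sigma> \<le> s")
      case True
      have "ennreal (q * s powr (q - 1)) * emeasure Q {x\<in>space Q. h x > s}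
          \<le> ennreal (q * s powr (q - 1)) * ennreal (c * s powr (-r))"
        using tail True assms by (intro mult_left_mono) auto
      also have "\<dots> = ennreal (c * q * s powr (q - r - 1))"
        using assms by (simp flip: ennreal_mult powr_add add: mult.assoc mult.left_commute algebra_simps)
      finally show ?thesis using True by simp
    qed auto
  qed
  \<comment> \<open>The primitive has the negative exponent q - r, so its limit at infinity is 0,
    and its coefficient is negative, so subtracting its value at \<sigma> gives a nonnegative
    number.\<close>
  also have "\<dots> = ennreal (0 - (c * q / (q - r) * \<sigma> powr (q - r)))"
  proof (intro nn_integral_FTC_atLeast)
    show "((\<lambda>s. c * q / (q - r) * s powr (q - r)) \<longlongrightarrow> 0) at_top"
      using tendsto_mult[OF tendsto_const tendsto_neg_powr[OF _ filterlim_ident], of "q - r" "c * q / (q - r)"]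
        \<open>q < r\<close> by simp
  next
    fix s :: real assume "\<sigma> \<le> s"
    then have "((\<lambda>s. c * q / (q - r) * s powr (q - r)) has_real_derivative
        c * q / (q - r) * ((q - r) * s powr (q - r - 1))) (at s)"
      using assms by (intro DERIV_cmult has_real_derivative_powr) auto
    then show "((\<lambda>s. c * q / (q - r) * s powr (q - r)) has_real_derivative
        c * q * s powr (q - r - 1)) (at s)"
      using assms by (simp add: mult.assoc)
  qed (use assms in auto)
  finally have "(\<integral>\<^sup>+x. ennreal (h x powr q) * indicator {x. h x > \<sigma>} x \<partial>Q) \<le>
     ennreal (\<sigma> powr q) * ennreal (c * \<sigma> powr (-r)) + ennreal (0 - (c * q / (q - r) * \<sigma> powr (q - r)))"
    using assms by (subst nn_integral_powr_layer_cake) (auto intro!: add_mono mult_left_mono)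
  also have "\<dots> = ennreal (c * \<sigma> powr (q - r) - c * q / (q - r) * \<sigma> powr (q - r))"
    using assms by (subst ennreal_mult[symmetric], simp, simp)
      (subst ennreal_plus[symmetric],
       auto simp flip: powr_add simp: mult.left_commute divide_nonneg_neg mult_nonpos_nonneg)
  also have "c * \<sigma> powr (q - r) - c * q / (q - r) * \<sigma> powr (q - r) = c * r / (r - q) * \<sigma> powr (q - r)"
    using assms by (simp add: field_simps)
  finally show ?thesis .
qed

text \<open>A superlevel set of measure exactly \<tau> may fail to exist when f is constant on a set
  of positive measure. The level set {f = z} is therefore taken with a fractional weight, as in the
  bathtub principle; z is the decreasing rearrangement of f at \<tau>. Having the exact measure
  matters later, as \<tau> is used both from above and from below.\<close>

lemma split_at_level:
  fixes f :: "'a \<Rightarrow> real"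
  assumes "finite_measure M" and f[measurable]: "f \<in> borel_measurable M" and nonneg: "\<And>y. 0 \<le> f y"
    and \<tau>: "0 < \<tau>" "\<tau> \<le> measure M (space M)"
  obtains \<theta> z where "\<theta> \<in> borel_measurable M" "\<And>y. 0 \<le> \<theta> y" "\<And>y. \<theta> y \<le> 1" "0 \<le> z"
    "\<And>y. 0 < \<theta> y \<Longrightarrow> z \<le> f y" "\<And>y. \<theta> y < 1 \<Longrightarrow> f y \<le> z" "(\<integral>\<^sup>+y. ennreal (\<theta> y) \<partial>M) = ennreal \<tau>"
proof -
  interpret finite_measure M by fact
  define d where "d s = measure M {y\<in>space M. f y > s}" for s
  define S where "S = {s. 0 \<le> s \<and> d s \<le> \<tau>}"
  define z where "z = Inf S"
  have d_mono: "d t \<le> d s" if "s \<le> t" for s t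
    unfolding d_def using that by (intro finite_measure_mono) auto
  have "(\<lambda>n::nat. d (real n)) \<longlonglongrightarrow> measure M (\<Inter>n::nat. {y\<in>space M. f y > real n})"
    unfolding d_def by (intro finite_Lim_measure_decseq) (auto simp: decseq_def)
  also have "(\<Inter>n::nat. {y\<in>space M. f y > real n}) = {}"
    using reals_Archimedean2[where 'a = real] by auto (metis less_asym)
  finally have "eventually (\<lambda>n. d (real n) < \<tau>) sequentially"
    using \<tau> by (intro order_tendstoD(2)) auto
  then obtain n :: nat where "d (real n) < \<tau>" by (auto simp: eventually_sequentially)
  then have "real n \<in> S" by (simp add: S_def)
  moreover have "bdd_below S" by (rule bdd_belowI[of _ 0]) (auto simp: S_def)
  ultimately have S: "S \<noteq> {}" "bdd_below S" by auto
  have "0 \<le> z" unfolding z_def using S by (intro cInf_greatest) (auto simp: S_def)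
  have anti: "1 / (real n + 1) \<le> 1 / (real m + 1)" if "m \<le> n" for m n
    using that by (intro frac_le) auto
  \<comment> \<open>Right continuity of the distribution function \<open>d\<close>: every number
    above z = \<open>Inf S\<close> exceeds some element of \<open>S\<close>.\<close>
  have "d z \<le> \<tau>"
  proof -
    have "(\<lambda>n::nat. d (z + 1 / (real n + 1))) \<longlonglongrightarrow> measure M (\<Union>n::nat. {y\<in>space M. f y > z + 1 / (real n + 1)})"
      unfolding d_def
      by (intro finite_Lim_measure_incseq) (auto simp: incseq_def, smt (verit, best) anti)
    also have "(\<Union>n::nat. {y\<in>space M. f y > z + 1 / (real n + 1)}) = {y\<in>space M. f y > z}"
    proof (safe; (simp; fail)?)
      fix y n assume "z + 1 / (real n + 1) < f y"
      then show "z < f y" by (smt (verit) divide_pos_pos of_nat_0_le_iff)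
    next
      fix y assume y: "y \<in> space M" "z < f y"
      then obtain n where "inverse (real (Suc n)) < f y - z" using reals_Archimedean[of "f y - z"] by auto
      then show "y \<in> (\<Union>n::nat. {y\<in>space M. f y > z + 1 / (real n + 1)})"
        using y by (auto intro!: exI[of _ n] simp: inverse_eq_divide add_ac)
    qed
    finally have "(\<lambda>n::nat. d (z + 1 / (real n + 1))) \<longlonglongrightarrow> d z" by (simp add: d_def)
    moreover have "d (z + 1 / (real n + 1)) \<le> \<tau>" for n :: nat
    proof -
      have "Inf S < z + 1 / (real n + 1)" unfolding z_def by (simp add: add_nonneg_pos)
      then obtain s where "s \<in> S" "s < z + 1 / (real n + 1)" using S cInf_lessD by blast
      then show ?thesis using d_mono[of s "z + 1 / (real n + 1)"] by (auto simp: S_def)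
    qed
    ultimately show ?thesis by (intro LIMSEQ_le_const2) auto
  qed
  \<comment> \<open>Approach from the left: levels below z lie outside \<open>S\<close>. A negative
    level is outside \<open>S\<close> for a trivial reason, so there the bound comes from f \<ge> 0,
    which makes the superlevel set the whole space.\<close>
  have ge: "\<tau> \<le> measure M {y\<in>space M. f y \<ge> z}"
  proof -
    have "(\<lambda>n::nat. d (z - 1 / (real n + 1))) \<longlonglongrightarrow> measure M (\<Inter>n::nat. {y\<in>space M. f y > z - 1 / (real n + 1)})"
      unfolding d_def
      by (intro finite_Lim_measure_decseq) (auto simp: decseq_def, smt (verit, best) anti)
    also have "(\<Inter>n::nat. {y\<in>space M. f y > z - 1 / (real n + 1)}) = {y\<in>space M. f y \<ge> z}"
    proof -
      have "z \<le> f y \<longleftrightarrow> (\<forall>n::nat. z - 1 / (real n + 1) < f y)" for y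
      proof
        assume "z \<le> f y"
        then show "\<forall>n::nat. z - 1 / (real n + 1) < f y" by (smt (verit) divide_pos_pos of_nat_0_le_iff)
      next
        assume *: "\<forall>n::nat. z - 1 / (real n + 1) < f y"
        show "z \<le> f y"
        proof (rule ccontr)
          assume "\<not> z \<le> f y"
          then obtain n where "inverse (real (Suc n)) < z - f y" using reals_Archimedean[of "z - f y"] by auto
          with *[rule_format, of n] show False by (auto simp: inverse_eq_divide add_ac)
        qed
      qed
      then show ?thesis by auto
    qed
    finally have "(\<lambda>n::nat. d (z - 1 / (real n + 1))) \<longlonglongrightarrow> measure M {y\<in>space M. f y \<ge> z}" .
    moreover have "\<tau> \<le> d (z - 1 / (real n + 1))" for n :: nat
    proof (cases "0 \<le> z - 1 / (real n + 1)")
      case True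
      have "z - 1 / (real n + 1) \<notin> S"
      proof
        assume "z - 1 / (real n + 1) \<in> S"
        then have "z \<le> z - 1 / (real n + 1)" unfolding z_def using S by (intro cInf_lower) (auto simp: z_def)
        then show False by (smt (verit) divide_pos_pos of_nat_0_le_iff)
      qed
      then show ?thesis using True by (auto simp: S_def)
    next
      case False
      then have "{y\<in>space M. f y > z - 1 / (real n + 1)} = space M"
        by auto (smt (verit, best) nonneg)
      then show ?thesis using \<tau> by (simp add: d_def)
    qed
    ultimately show ?thesis by (intro LIMSEQ_le_const) auto
  qed
  define e where "e = measure M {y\<in>space M. f y = z}"
  have sum: "measure M {y\<in>space M. f y \<ge> z} = d z + e"
  proof -
    have "{y\<in>space M. f y \<ge> z} = {y\<in>space M. f y > z} \<union> {y\<in>space M. f y = z}" by auto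
    then show ?thesis unfolding d_def e_def by (simp add: finite_measure_Union disjoint_iff)
  qed
  have "e \<ge> 0" by (simp add: e_def)
  \<comment> \<open>If the level set is null, then e = 0 and the quotient is 0 by convention; the
    two inequalities above then force \<open>d z = \<tau>\<close>, so the identity for
    \<open>\<tau>\<close> still holds.\<close>
  define c where "c = (\<tau> - d z) / e"
  have c: "0 \<le> c" "c \<le> 1" "d z + c * e = \<tau>"
    using ge \<open>d z \<le> \<tau>\<close> \<open>e \<ge> 0\<close> unfolding sum c_def by (auto simp: divide_le_eq_1)
  define \<theta> where "\<theta> y = (if f y > z then 1 else if f y = z then c else 0)" for y
  show thesis
  proof (rule that[of \<theta> z])
    show [measurable]: "\<theta> \<in> borel_measurable M" unfolding \<theta>_def by measurable
    have "(\<integral>\<^sup>+y. ennreal (\<theta> y) \<partial>M) =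
      (\<integral>\<^sup>+y. indicator {y\<in>space M. f y > z} y + ennreal c * indicator {y\<in>space M. f y = z} y \<partial>M)"
      by (intro nn_integral_cong) (auto simp: \<theta>_def indicator_def)
    also have "\<dots> = emeasure M {y\<in>space M. f y > z} + ennreal c * emeasure M {y\<in>space M. f y = z}"
      by (subst nn_integral_add) (auto simp: nn_integral_cmult)
    also have "\<dots> = ennreal (d z + c * e)"
      using c(1) by (simp add: emeasure_eq_measure d_def e_def ennreal_plus ennreal_mult)
    finally show "(\<integral>\<^sup>+y. ennreal (\<theta> y) \<partial>M) = ennreal \<tau>" using c by simp
  qed (use c \<open>0 \<le> z\<close> in \<open>auto simp: \<theta>_def split: if_splits\<close>)
qed

subsection \<open>Sparse level sets\<close>

lemma Holder_two:
  fixes a1 a2 b1 b2 :: real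
  assumes pq: "q > 1" "p > 1" "1/q + 1/p = 1" and nn: "0 \<le> a1" "0 \<le> a2" "0 \<le> b1" "0 \<le> b2"
  shows "a1 * b1 + a2 * b2 \<le> (a1 powr q + a2 powr q) powr (1/q) * (b1 powr p + b2 powr p) powr (1/p)"
proof (cases "(a1 = 0 \<and> a2 = 0) \<or> (b1 = 0 \<and> b2 = 0)")
  case False
  define S T where "S = a1 powr q + a2 powr q" and "T = b1 powr p + b2 powr p"
  have ST: "S > 0" "T > 0" using nn False by (auto simp: S_def T_def add_pos_nonneg add_nonneg_pos)
  define s t where "s = S powr (1/q)" and "t = T powr (1/p)"
  have st: "s > 0" "t > 0" "s powr q = S" "t powr p = T"
    using ST pq by (auto simp: s_def t_def powr_powr)
  have y: "(a / s) * (b / t) \<le> a powr q / (q * S) + b powr p / (p * T)" if "0 \<le> a" "0 \<le> b" for a b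
  proof -
    have "(a / s) * (b / t) \<le> (a / s) powr q / q + (b / t) powr p / p"
      using st that pq by (intro Youngs_inequality) auto
    then show ?thesis using st that by (simp add: powr_divide mult.commute)
  qed
  have "(a1 / s) * (b1 / t) + (a2 / s) * (b2 / t)
      \<le> (a1 powr q / (q * S) + b1 powr p / (p * T)) + (a2 powr q / (q * S) + b2 powr p / (p * T))"
    using nn by (intro add_mono y) auto
  also have "\<dots> = S / (q * S) + T / (p * T)" by (simp add: S_def T_def add_divide_distrib)
  also have "\<dots> = 1" using ST pq by simp
  finally have "(a1 * b1 + a2 * b2) / (s * t) \<le> 1" by (simp add: add_divide_distrib)
  then show ?thesis using st by (simp add: s_def t_def S_def T_def divide_le_eq)
qed auto

text \<open>A bound linear in x that holds for exponents on either side of 1, at the price of a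
  slope depending on the range of x. It follows from 1 + x \<le> exp x and exp t \<le> 1 + t exp
  t.\<close>

lemma one_plus_powr_le:
  fixes s x X :: real
  assumes "0 \<le> s" "0 \<le> x" "x \<le> X"
  shows "(1 + x) powr s \<le> 1 + s * exp (s * X) * x"
proof -
  have "(1 + x) powr s \<le> exp x powr s" using assms by (intro powr_mono2) auto
  also have "\<dots> = exp (s * x)" by (simp add: powr_def)
  also have "\<dots> \<le> 1 + (s * x) * exp (s * x)"
  proof -
    have "1 - s * x \<le> exp (-(s * x))" using exp_ge_add_one_self[of "-(s * x)"] by simp
    then have "exp (s * x) * (1 - s * x) \<le> exp (s * x) * exp (-(s * x))" by (intro mult_left_mono) auto
    also have "\<dots> = 1" by (simp flip: exp_add)
    finally show ?thesis by (simp add: algebra_simps)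
  qed
  also have "\<dots> \<le> 1 + (s * x) * exp (s * X)"
    using assms by (intro add_left_mono mult_left_mono) (auto intro: mult_left_mono)
  finally show ?thesis by (simp add: mult_ac)
qed

text \<open>The two displayed premises are the same estimate, for one splitting of f with upper mass
  \<open>m\<close>, tested at the levels \<open>w1\<close> and \<open>w2\<close>. Put L = w1 + \<mu>
  + c. The first premise says that losing mass m costs about m L and gains at most a multiple of (m
  L)^(1/p), so m L = O(\<mu>). In the second, Hoelder combines the two summands and yields w2 \<le>
  (L + (w2 - w1 + 1)/2) (1 + G m)^(\<beta>-1); as m L = O(\<mu>), the second factor adds only
  O(\<mu>) and a fraction of w2 - w1 that can be absorbed.\<close>

lemma gap_estimate:
  fixes \<beta> p c C :: real
  assumes \<beta>: "\<beta> > 1" "p > 1" "1/\<beta> + 1/p = 1" and c: "c \<ge> 0" "C > 0"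
  obtains K where "K > 0"
    "\<And>\<mu> w1 w2 m. \<lbrakk>1 \<le> \<mu>; 0 \<le> m; m \<le> 1; K * \<mu> \<le> w1; w1 \<le> w2;
      w1 powr (1/\<beta>) \<le> (w1 + \<mu> + c) powr (1/\<beta>) * (1 - m) powr (1/p) + C * m powr (1/p);
      w2 powr (1/\<beta>) \<le> (w1 + \<mu> + c) powr (1/\<beta>) * (1 - m) powr (1/p) + C * (w2 - w1 + 1) powr (1/\<beta>) * m powr (1/p)\<rbrakk>
      \<Longrightarrow> w2 - w1 \<le> K * \<mu>"
proof -
  have pb: "1/p = 1 - 1/\<beta>" "\<beta> / p = \<beta> - 1" "(1 - 1/\<beta>) * \<beta> = \<beta> - 1"
    using \<beta> by (auto simp: field_simps)
  \<comment> \<open>If m L exceeded \<open>K1 * \<mu>\<close>, the second summand would make C (m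
    L)^(1/p) at most half of m L / p, and the first would contradict what remains.\<close>
  define K1 where "K1 = 2 * p * (c + 1) + (2 * p * C) powr \<beta>"
  \<comment> \<open>This weight in the two-term Hoelder inequality makes $(\Gamma Y)^\beta = (\delta + 1)/2$, which can be absorbed.\<close>
  define \<Gamma> where "\<Gamma> = (1/2) powr (1/\<beta>) / C"
  \<comment> \<open>\<open>G\<close> is the price of the weight \<open>\<Gamma>\<close> on the other
    factor, and \<open>G'\<close> the slope of (1 + G m)^(\<beta>-1) in m for 0 \<le> m \<le> 1. In
    \<open>K\<close> the factor 4 arises because three quarters of w2 - w1 are absorbed; the last 1
    takes care of additive constants, using \<mu> \<ge> 1.\<close>
  define G where "G = (1 / \<Gamma>) powr p"
  define G' where "G' = (\<beta> - 1) * exp ((\<beta> - 1) * G) * G"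
  define K where "K = 4 * (c + 1 + G' * K1 + 1)"
  have "\<Gamma> > 0" using c by (auto simp: \<Gamma>_def)
  have "K1 > 0" using \<beta> c by (auto simp: K1_def intro!: add_pos_nonneg)
  have "G > 0" using \<open>\<Gamma> > 0\<close> by (auto simp: G_def)
  have "G' \<ge> 0" using \<open>G > 0\<close> \<beta> by (auto simp: G'_def)
  have "0 \<le> G' * K1" using \<open>K1 > 0\<close> \<open>G' \<ge> 0\<close> by simp
  then have "0 < c + 1 + G' * K1 + 1" using c by (intro add_nonneg_pos add_nonneg_nonneg) auto
  then have "K > 0" by (simp add: K_def)
  then show thesis
  proof (rule that)
    fix \<mu> w1 w2 m :: real
    assume \<mu>: "1 \<le> \<mu>" and m: "0 \<le> m" "m \<le> 1" and w: "K * \<mu> \<le> w1" "w1 \<le> w2"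
      and le1: "w1 powr (1/\<beta>) \<le> (w1 + \<mu> + c) powr (1/\<beta>) * (1 - m) powr (1/p) + C * m powr (1/p)"
      and le2: "w2 powr (1/\<beta>) \<le> (w1 + \<mu> + c) powr (1/\<beta>) * (1 - m) powr (1/p) + C * (w2 - w1 + 1) powr (1/\<beta>) * m powr (1/p)"
    define L where "L = w1 + \<mu> + c"
    have "0 \<le> K * \<mu>" using \<open>K > 0\<close> \<mu> by simp
    then have "0 \<le> w1" using w by simp
    then have L: "L > 0" "\<mu> + c \<le> L" using \<mu> c by (auto simp: L_def)
    have cl: "\<mu> + c \<le> (c + 1) * \<mu>" using mult_left_mono[of 1 \<mu> c] \<mu> c by (simp add: algebra_simps)
    have mL: "m * L \<le> K1 * \<mu>"
    proof -
      have bern: "(1 - m) powr (1/p) \<le> 1 - m / p"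
      proof (cases "m = 1")
        case False
        have "(1 - m) powr (1/p) * 1 powr (1/\<beta>) \<le> 1/p * (1 - m) + 1/\<beta> * 1"
          using \<open>m \<noteq> 1\<close> \<beta> m by (intro Youngs_inequality_0) auto
        also have "1/p * (1 - m) + 1/\<beta> * 1 = (1/\<beta> + 1/p) - m / p"
          by (simp add: algebra_simps diff_divide_distrib)
        finally show ?thesis unfolding \<beta>(3) by simp
      qed (use \<beta> in auto)
      \<comment> \<open>The level \<open>w1\<close> is written as L (1 - (\<mu> + c)/L) so that both
        sides carry the common factor L^(1/\<beta>). For a base in [0,1] the root is at least the
        base itself.\<close>
      have "L powr (1/\<beta>) * (1 - (\<mu> + c) / L) \<le> L powr (1/\<beta>) * (1 - (\<mu> + c) / L) powr (1/\<beta>)"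
        using L \<mu> c \<beta> powr_mono'[of "1/\<beta>" 1 "1 - (\<mu> + c) / L"] by (intro mult_left_mono) auto
      also have "\<dots> = (L * (1 - (\<mu> + c) / L)) powr (1/\<beta>)"
        using L by (intro powr_mult[symmetric])
      also have "L * (1 - (\<mu> + c) / L) = w1" using L by (simp add: right_diff_distrib L_def)
      also note le1
      also have "(w1 + \<mu> + c) powr (1/\<beta>) * (1 - m) powr (1/p) + C * m powr (1/p) \<le> L powr (1/\<beta>) * (1 - m / p) + C * m powr (1/p)"
        using bern by (simp add: L_def mult_left_mono)
      finally have "L powr (1/\<beta>) * (m / p - (\<mu> + c) / L) \<le> C * m powr (1/p)" by (simp add: algebra_simps)
      \<comment> \<open>Multiplication by L^(1/p) completes L^(1/\<beta>) to L and merges with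
        m^(1/p), leaving an inequality in the single quantity m L.\<close>
      then have "L powr (1/p) * (L powr (1/\<beta>) * (m / p - (\<mu> + c) / L)) \<le> L powr (1/p) * (C * m powr (1/p))"
        by (intro mult_left_mono) auto
      also have "L powr (1/p) * (L powr (1/\<beta>) * (m / p - (\<mu> + c) / L)) = L * (m / p - (\<mu> + c) / L)"
        using L pb by (simp add: mult.assoc[symmetric] flip: powr_add)
      also have "\<dots> = m * L / p - (\<mu> + c)" using L by (simp add: right_diff_distrib mult.commute)
      also have "L powr (1/p) * (C * m powr (1/p)) = C * (m * L) powr (1/p)"
        using L m by (simp add: powr_mult)
      finally have main: "m * L / p \<le> (c + 1) * \<mu> + C * (m * L) powr (1/p)" using cl by simp
      show ?thesis
      proof (rule ccontr)
        assume "\<not> m * L \<le> K1 * \<mu>"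
        then have big: "K1 * \<mu> < m * L" by simp
        have K1_pos: "0 \<le> (2 * p * C) powr \<beta>" "0 \<le> 2 * p * (c + 1)" using \<beta> c by auto
        have "K1 \<le> K1 * \<mu>" using \<open>K1 > 0\<close> \<mu> by simp
        then have "(2 * p * C) powr \<beta> \<le> m * L" using big K1_pos by (simp add: K1_def)
        then have "((2 * p * C) powr \<beta>) powr (1/\<beta>) \<le> (m * L) powr (1/\<beta>)" using \<beta> by (intro powr_mono2) auto
        then have "2 * p * C \<le> (m * L) powr (1/\<beta>)" using \<beta> c by (simp add: powr_powr)
        then have "(m * L) powr (1/p) * (2 * p * C) \<le> (m * L) powr (1/p) * (m * L) powr (1/\<beta>)"
          by (intro mult_left_mono) auto
        also have "\<dots> = m * L" using pb m L by (simp flip: powr_add)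
        finally have "C * (m * L) powr (1/p) \<le> m * L / p / 2" using \<beta> by (simp add: field_simps)
        then have "m * L / p / 2 \<le> (c + 1) * \<mu>" using main by linarith
        then have "m * L \<le> 2 * p * (c + 1) * \<mu>" using \<beta> by (simp add: field_simps)
        also have "\<dots> \<le> K1 * \<mu>" using K1_pos \<mu> by (intro mult_right_mono) (auto simp: K1_def)
        finally show False using big by simp
      qed
    qed
    define \<delta> where "\<delta> = w2 - w1"
    have "\<delta> \<ge> 0" using w by (simp add: \<delta>_def)
    define Y where "Y = C * (\<delta> + 1) powr (1/\<beta>)"
    have Y: "(\<Gamma> * Y) powr \<beta> = (\<delta> + 1) / 2" "0 \<le> Y"
      using \<open>\<delta> \<ge> 0\<close> c \<beta> by (simp_all add: Y_def \<Gamma>_def powr_mult powr_powr powr_divide)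
    have Gm: "(m powr (1/p) / \<Gamma>) powr p = G * m"
      using \<open>\<Gamma> > 0\<close> m \<beta> by (simp add: G_def powr_divide powr_powr)
    \<comment> \<open>At the higher level the loss factor (1-m)^(1/p) may be dropped; only the
      smallness of m, already known, is still required.\<close>
    have "w2 powr (1/\<beta>) \<le> L powr (1/\<beta>) * 1 + (\<Gamma> * Y) * (m powr (1/p) / \<Gamma>)"
    proof -
      have "(1 - m) powr (1/p) \<le> 1" using m \<beta> by (intro powr_le1) auto
      then have "L powr (1/\<beta>) * (1 - m) powr (1/p) \<le> L powr (1/\<beta>) * 1" by (intro mult_left_mono) auto
      then show ?thesis using le2 \<open>\<Gamma> > 0\<close> by (simp add: L_def Y_def \<delta>_def)
    qed
    also have "\<dots> \<le> ((L powr (1/\<beta>)) powr \<beta> + (\<Gamma> * Y) powr \<beta>) powr (1/\<beta>) * (1 powr p + (m powr (1/p) / \<Gamma>) powr p) powr (1/p)"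
      using \<beta> L Y \<open>\<Gamma> > 0\<close> by (intro Holder_two) auto
    also have "\<dots> = (L + (\<delta> + 1) / 2) powr (1/\<beta>) * (1 + G * m) powr (1/p)"
      unfolding Y Gm using \<beta> L by (simp add: powr_powr)
    finally have "(w2 powr (1/\<beta>)) powr \<beta> \<le> ((L + (\<delta> + 1) / 2) powr (1/\<beta>) * (1 + G * m) powr (1/p)) powr \<beta>"
      using \<beta> by (intro powr_mono2) auto
    then have "w2 \<le> (L + (\<delta> + 1) / 2) * (1 + G * m) powr (\<beta> - 1)"
      using \<beta> \<open>0 \<le> w1\<close> w L \<open>\<delta> \<ge> 0\<close> pb by (simp add: powr_powr powr_mult)
    also have "\<dots> \<le> (L + (\<delta> + 1) / 2) * (1 + G' * m)"
    proof (intro mult_left_mono)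
      have "(1 + G * m) powr (\<beta> - 1) \<le> 1 + (\<beta> - 1) * exp ((\<beta> - 1) * G) * (G * m)"
        using \<beta> \<open>G > 0\<close> m by (intro one_plus_powr_le) (auto intro: mult_left_le)
      then show "(1 + G * m) powr (\<beta> - 1) \<le> 1 + G' * m" by (simp add: G'_def mult_ac)
    qed (use L \<open>\<delta> \<ge> 0\<close> in auto)
    also have "\<dots> = L + G' * (m * L) + (\<delta> + 1) / 2 * (1 + G' * m)" by (simp add: algebra_simps)
    \<comment> \<open>Since L \<ge> K \<mu> \<ge> 2 G' K1 \<mu>, the bound on m L gives G' m \<le>
      1/2. The coefficient of \<delta> thus becomes (1/2)(3/2) = 3/4, which is less than 1.\<close>
    also have "\<dots> \<le> L + G' * (K1 * \<mu>) + (\<delta> + 1) / 2 * (1 + 1/2)"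
    proof (intro add_mono mult_left_mono order_refl)
      have "2 * (G' * K1) \<le> K" using c \<open>G' \<ge> 0\<close> \<open>K1 > 0\<close> by (auto simp: K_def)
      then have "2 * (G' * K1) * \<mu> \<le> K * \<mu>" using \<mu> by (intro mult_right_mono) auto
      also have "\<dots> \<le> L" using w \<mu> c by (simp add: L_def)
      finally have "G' * (K1 * \<mu>) \<le> L / 2" by simp
      moreover have "G' * (m * L) \<le> G' * (K1 * \<mu>)" using mL \<open>G' \<ge> 0\<close> by (intro mult_left_mono)
      ultimately have "(G' * m) * L \<le> (1/2) * L" by (simp add: mult_ac)
      then show "G' * m \<le> 1/2" using L by (subst (asm) mult_le_cancel_right_pos) auto
    qed (use mL \<open>G' \<ge> 0\<close> \<open>\<delta> \<ge> 0\<close> in auto)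
    finally have "\<delta> \<le> 4 * (\<mu> + c + G' * K1 * \<mu>) + 3"
      by (simp add: L_def \<delta>_def field_simps)
    also have "\<dots> \<le> 4 * ((c + 1) * \<mu> + G' * K1 * \<mu>) + 4 * \<mu>" using cl \<mu> by (simp add: algebra_simps)
    also have "\<dots> = K * \<mu>" by (simp add: K_def algebra_simps)
    finally show "w2 - w1 \<le> K * \<mu>" by (simp add: \<delta>_def)
  qed
qed

text \<open>Sort the indices by the size of a_n in powers of exp(-b). The gap hypothesis with \<mu>
  = j + 1 leaves O(j + 1) indices with a_n \<ge> exp(-b (j+1)): those below K (j+1), and those in
  one window of length K (j+1). The series of (j+1) exp(-b j) converges, and S depends on neither a
  nor n.\<close>

lemma sum_bound_of_sparse_levels:
  fixes K b c0 :: real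
  assumes "K > 0" "b > 0" "c0 \<ge> 0"
  obtains S where "S \<ge> 0"
    "\<And>a n. \<lbrakk>\<And>n. 0 \<le> a n; \<And>n. a n \<le> exp (b * c0);
       \<And>\<mu> n1 n2. \<lbrakk>1 \<le> \<mu>; n1 \<le> n2; K * \<mu> \<le> real n1; exp (-(b * \<mu>)) \<le> a n1; exp (-(b * \<mu>)) \<le> a n2\<rbrakk>
          \<Longrightarrow> real n2 - real n1 \<le> K * \<mu>\<rbrakk> \<Longrightarrow> (\<Sum>i<n. a i) \<le> S"
proof -
  \<comment> \<open>Half of the decay exp(-b j) is spent on the counting factor, through j + 1 \<le>
    (1 + 2/b) exp(b j / 2); the other half is the ratio of the geometric series.\<close>
  define r where "r = exp (-(b / 2))"
  have r: "0 < r" "r < 1" using assms by (auto simp: r_def)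
  define K' where "K' = (2 * K + 3) * (1 + 2 / b)"
  have "K' \<ge> 0" using assms by (auto simp: K'_def)
  define S where "S = 1 + exp (b * c0) * K' / (1 - r)"
  have "S \<ge> 0" using r \<open>K' \<ge> 0\<close> by (auto simp: S_def)
  then show thesis
  proof (rule that)
    fix a :: "nat \<Rightarrow> real" and n :: nat
    assume nonneg: "\<And>n. 0 \<le> a n" and bound: "\<And>n. a n \<le> exp (b * c0)"
      and gap: "\<And>\<mu> n1 n2. \<lbrakk>1 \<le> \<mu>; n1 \<le> n2; K * \<mu> \<le> real n1; exp (-(b * \<mu>)) \<le> a n1; exp (-(b * \<mu>)) \<le> a n2\<rbrakk>
          \<Longrightarrow> real n2 - real n1 \<le> K * \<mu>"
    define P where "P j = {i. exp (-(b * (real j + 1))) \<le> a i}" for j :: nat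
    \<comment> \<open>\<open>g j\<close> dominates a_i when j is the first index with
      \<open>i \<in> P j\<close>. For j > 0 this is because i misses \<open>P (j - 1)\<close>; for j
      = 0 only the uniform bound is available, which is where the factor exp(b c0) comes
      from.\<close>
    define g where "g j = exp (b * c0) * exp (-(b * real j))" for j :: nat
    have card: "card (P j \<inter> {..<n}) \<le> (2 * K + 3) * (real j + 1)" for j
    proof -
      define \<Lambda> where "\<Lambda> = K * (real j + 1)"
      have "\<Lambda> \<ge> 0" using assms by (auto simp: \<Lambda>_def)
      \<comment> \<open>The gap hypothesis says nothing about indices below
        \<open>\<Lambda>\<close>; these are simply counted. The others all lie within
        \<open>\<Lambda>\<close> of their minimum.\<close>
      define P1 P2 where "P1 = {i \<in> P j \<inter> {..<n}. real i < \<Lambda>}" and "P2 = {i \<in> P j \<inter> {..<n}. \<Lambda> \<le> real i}"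
      have "P1 \<subseteq> {..nat \<lfloor>\<Lambda>\<rfloor>}" by (auto simp: P1_def le_nat_floor)
      from card_mono[OF _ this] have "card P1 \<le> nat \<lfloor>\<Lambda>\<rfloor> + 1" by simp
      then have c1: "real (card P1) \<le> \<Lambda> + 1" using \<open>\<Lambda> \<ge> 0\<close> by linarith
      have c2: "real (card P2) \<le> \<Lambda> + 1"
      proof (cases "P2 = {}")
        case False
        have fin: "finite P2" by (auto simp: P2_def)
        define n1 where "n1 = Min P2"
        have n1: "n1 \<in> P2" using Min_in[OF fin False] by (simp add: n1_def)
        have "P2 \<subseteq> {n1..n1 + nat \<lfloor>\<Lambda>\<rfloor>}"
        proof
          fix i assume i: "i \<in> P2"
          have "n1 \<le> i" using i fin by (simp add: n1_def)
          moreover have "real i - real n1 \<le> \<Lambda>"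
            unfolding \<Lambda>_def using n1 i \<open>n1 \<le> i\<close> by (intro gap) (auto simp: P2_def P_def \<Lambda>_def)
          then have "real (i - n1) \<le> \<Lambda>" using \<open>n1 \<le> i\<close> by (simp add: of_nat_diff)
          then have "i - n1 \<le> nat \<lfloor>\<Lambda>\<rfloor>" by (rule le_nat_floor)
          ultimately show "i \<in> {n1..n1 + nat \<lfloor>\<Lambda>\<rfloor>}" by auto
        qed
        from card_mono[OF _ this] have "card P2 \<le> nat \<lfloor>\<Lambda>\<rfloor> + 1" by simp
        then show ?thesis using \<open>\<Lambda> \<ge> 0\<close> by linarith
      qed (use \<open>\<Lambda> \<ge> 0\<close> in auto)
      have "P j \<inter> {..<n} = P1 \<union> P2" by (auto simp: P1_def P2_def)
      then have "real (card (P j \<inter> {..<n})) \<le> real (card P1) + real (card P2)"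
        using card_Un_le[of P1 P2] by simp
      also have "\<dots> \<le> 2 * \<Lambda> + 2" using c1 c2 by simp
      also have "\<dots> \<le> (2 * K + 3) * (real j + 1)" by (simp add: \<Lambda>_def algebra_simps)
      finally show ?thesis .
    qed
    \<comment> \<open>Indices with very small a_i, in particular those with a_i = 0, belong to no
      \<open>P j\<close> with j \<le> J. For J large in terms of n they contribute less than 1
      altogether.\<close>
    have "(\<lambda>J. real n * exp (-(b * (real J + 1)))) \<longlonglongrightarrow> 0"
    proof -
      have "(\<lambda>J. real n * exp (-b) * exp (-b) ^ J) \<longlonglongrightarrow> real n * exp (-b) * 0"
        using \<open>b > 0\<close> by (intro tendsto_mult tendsto_const LIMSEQ_power_zero) auto
      also have "(\<lambda>J. real n * exp (-b) * exp (-b) ^ J) = (\<lambda>J. real n * exp (-(b * (real J + 1))))"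
        by (simp add: algebra_simps flip: exp_of_nat_mult exp_add)
      finally show ?thesis by simp
    qed
    then have "eventually (\<lambda>J. real n * exp (-(b * (real J + 1))) < 1) sequentially"
      by (rule order_tendstoD) auto
    then obtain J where J: "real n * exp (-(b * (real J + 1))) < 1" by (auto simp: eventually_sequentially)
    have pointwise: "a i \<le> exp (-(b * (real J + 1))) + (\<Sum>j\<le>J. g j * of_bool (i \<in> P j))" for i
    proof (cases "\<exists>j\<le>J. i \<in> P j")
      case True
      define j where "j = (LEAST j. i \<in> P j)"
      have j: "i \<in> P j" unfolding j_def using True by (metis LeastI)
      have "j \<le> J" unfolding j_def using True by (meson Least_le order_trans)
      have "a i \<le> g j"
      proof (cases j)
        case 0
        then show ?thesis using bound[of i] by (simp add: g_def)
      next
        case (Suc j')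
        then have "i \<notin> P j'" unfolding j_def by (metis lessI not_less_Least)
        then have "a i \<le> exp (-(b * real j))" using Suc by (auto simp: P_def add_ac)
        also have "\<dots> \<le> g j" using assms by (simp add: g_def)
        finally show ?thesis .
      qed
      also have "\<dots> = g j * of_bool (i \<in> P j)" using j by simp
      also have "\<dots> \<le> (\<Sum>j\<le>J. g j * of_bool (i \<in> P j))"
        using \<open>j \<le> J\<close> by (intro member_le_sum) (auto simp: g_def)
      finally show ?thesis by (simp add: add_increasing)
    next
      case False
      then have "i \<notin> P J" by auto
      then have "a i \<le> exp (-(b * (real J + 1)))" by (auto simp: P_def)
      moreover have "0 \<le> (\<Sum>j\<le>J. g j * of_bool (i \<in> P j))" by (intro sum_nonneg) (auto simp: g_def)
      ultimately show ?thesis by simp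
    qed
    have "(\<Sum>i<n. a i) \<le> (\<Sum>i<n. exp (-(b * (real J + 1))) + (\<Sum>j\<le>J. g j * of_bool (i \<in> P j)))"
      by (intro sum_mono pointwise)
    also have "\<dots> = real n * exp (-(b * (real J + 1))) + (\<Sum>j\<le>J. \<Sum>i<n. g j * of_bool (i \<in> P j))"
      using sum.swap[of "\<lambda>i j. g j * of_bool (i \<in> P j)" "{..J}" "{..<n}"]
      by (simp only: sum.distrib sum_constant card_lessThan)
    also have "\<dots> \<le> 1 + (\<Sum>j\<le>J. exp (b * c0) * K' * r ^ j)"
    proof (intro add_mono sum_mono)
      fix j
      have "(\<Sum>i<n. g j * of_bool (i \<in> P j)) = g j * real (card (P j \<inter> {..<n}))"
        by (simp add: sum_distrib_left[symmetric] of_bool_def sum.If_cases Int_commute)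
      also have "\<dots> \<le> g j * ((2 * K + 3) * (real j + 1))"
        by (intro mult_left_mono card) (auto simp: g_def)
      also have "\<dots> \<le> g j * (K' * exp (b / 2 * real j))"
      proof (intro mult_left_mono)
        have "real j + 1 \<le> (1 + 2 / b) * (1 + b / 2 * real j)"
          using assms by (simp add: field_simps)
        also have "\<dots> \<le> (1 + 2 / b) * exp (b / 2 * real j)"
          using assms by (intro mult_left_mono exp_ge_add_one_self) auto
        finally show "(2 * K + 3) * (real j + 1) \<le> K' * exp (b / 2 * real j)"
          unfolding K'_def mult.assoc using assms by (intro mult_left_mono) auto
      qed (auto simp: g_def)
      also have "\<dots> = exp (b * c0) * K' * r ^ j"
        by (simp add: g_def r_def algebra_simps flip: exp_of_nat_mult exp_add)
      finally show "(\<Sum>i<n. g j * of_bool (i \<in> P j)) \<le> exp (b * c0) * K' * r ^ j" .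
    qed (use J in auto)
    also have "\<dots> = 1 + exp (b * c0) * K' * (\<Sum>j\<le>J. r ^ j)" by (simp add: sum_distrib_left)
    also have "\<dots> \<le> 1 + exp (b * c0) * K' * (1 / (1 - r))"
    proof (intro add_left_mono mult_left_mono)
      have "(\<Sum>j\<le>J. r ^ j) = (1 - r ^ Suc J) / (1 - r)" using r by (simp add: sum_gp0)
      also have "\<dots> \<le> 1 / (1 - r)" using r by (intro divide_right_mono) auto
      finally show "(\<Sum>j\<le>J. r ^ j) \<le> 1 / (1 - r)" .
    qed (use \<open>K' \<ge> 0\<close> in auto)
    finally show "(\<Sum>i<n. a i) \<le> S" by (simp add: S_def)
  qed
qed

subsection \<open>Kernels with two-sided tail bounds\<close>

text \<open>The hypotheses on rearrangements, turned into tail bounds uniform in the other variable.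
  The condition \<open>s0 \<ge> exp 1\<close> makes ln s \<ge> 1 beyond s0, so the logarithmic
  correction is at most C0 wherever a crude bound is enough.\<close>

locale adams_kernel = M: finite_measure M + N: finite_measure N
  for M :: "'a measure" and N :: "'b measure" +
  fixes k :: "'b \<Rightarrow> 'a \<Rightarrow> real" and A B C0 s0 \<beta> \<gamma> \<beta>0 :: real
  assumes k_measurable: "(\<lambda>(x, y). k x y) \<in> borel_measurable (N \<Otimes>\<^sub>M M)"
    and k_nonneg: "\<And>x y. 0 \<le> k x y"
    and A_pos: "A > 0" and B_pos: "B > 0" and beta: "\<beta> > 1" and gamma: "\<gamma> > 1"
    and beta0: "\<beta>0 > 0" and C0: "C0 \<ge> 0" and s0: "s0 \<ge> exp 1"
    and tail1: "\<And>x s. x \<in> space N \<Longrightarrow> s0 \<le> s \<Longrightarrow>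
      emeasure M {y\<in>space M. k x y > s} \<le> ennreal (A * s powr (-\<beta>) * (1 + C0 * ln s powr (-\<gamma>)))"
    and tail2: "\<And>y s. y \<in> space M \<Longrightarrow> s0 \<le> s \<Longrightarrow>
      emeasure N {x\<in>space N. k x y > s} \<le> ennreal (B * s powr (-\<beta>0))"
begin

lemma k_meas_pair [measurable (raw)]:
  assumes "g \<in> measurable L N" "h \<in> measurable L M"
  shows "(\<lambda>w. k (g w) (h w)) \<in> borel_measurable L"
  using measurable_compose[OF measurable_Pair[OF assms] k_measurable] by simp

lemma s0_ge: "s0 \<ge> 1" "s0 > 0"
  using s0 one_le_exp_iff[of 1] exp_gt_zero[of 1] by (linarith+)

lemma ln_ge_1: "s0 \<le> s \<Longrightarrow> 1 \<le> ln s"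
  using s0 s0_ge by (subst ln_ge_iff) auto

lemma log_correction_le: "s0 \<le> s \<Longrightarrow> ln s powr (-\<gamma>) \<le> 1"
  using ln_ge_1[of s] gamma powr_mono2'[of "-\<gamma>" 1 "ln s"] by auto

text \<open>Below s0 the total mass is the bound, and s0^r s^(-r) \<ge> 1 brings it into the form of
  the tail. The cost is a larger constant, so this is used only where the sharp A does not
  matter.\<close>

lemma extend_tail:
  assumes "finite_measure Q" "r > 0" "c \<ge> 0"
    and le: "\<And>s. s0 \<le> s \<Longrightarrow> emeasure Q {x\<in>space Q. h x > s} \<le> ennreal (c * s powr (-r))"
    and "1 \<le> s"
  shows "emeasure Q {x\<in>space Q. h x > s} \<le> ennreal ((c + measure Q (space Q) * s0 powr r) * s powr (-r))"
proof (cases "s0 \<le> s")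
  case True
  have "ennreal (c * s powr (-r)) \<le> ennreal ((c + measure Q (space Q) * s0 powr r) * s powr (-r))"
    by (intro ennreal_leI mult_right_mono) auto
  then show ?thesis using le[OF True] by (rule order_trans[rotated])
next
  case False
  interpret Q: finite_measure Q by fact
  have "emeasure Q {x\<in>space Q. h x > s} \<le> ennreal (measure Q (space Q))"
    by (metis (no_types, lifting) Q.emeasure_eq_measure emeasure_space)
  also have "\<dots> \<le> ennreal ((c + measure Q (space Q) * s0 powr r) * s powr (-r))"
  proof (intro ennreal_leI)
    have "1 \<le> s0 powr r * s powr (-r)"
      using False \<open>1 \<le> s\<close> \<open>r > 0\<close> by (auto simp: powr_minus field_simps intro!: powr_mono2)
    then have "measure Q (space Q) * 1 \<le> measure Q (space Q) * (s0 powr r * s powr (-r))"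
      by (intro mult_left_mono) auto
    moreover have "0 \<le> c * s powr (-r)" using \<open>c \<ge> 0\<close> by auto
    ultimately show "measure Q (space Q) \<le> (c + measure Q (space Q) * s0 powr r) * s powr (-r)"
      by (simp add: algebra_simps)
  qed
  finally show ?thesis .
qed

section \<open>Truncated moments of the kernel\<close>

text \<open>For q < \<beta> the moment is dominated by its lower end, so the logarithmic correction
  can be replaced by the constant factor 1 + C0.\<close>

lemma tail_moment1:
  assumes "0 < q" "q < \<beta>"
  obtains c where "c > 0" "\<And>x \<sigma>. x \<in> space N \<Longrightarrow> 1 \<le> \<sigma> \<Longrightarrow>
    (\<integral>\<^sup>+y. ennreal (k x y powr q) * indicator {y. k x y > \<sigma>} y \<partial>M) \<le> ennreal (c * \<sigma> powr (q - \<beta>))"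
proof -
  define c where "c = A * (1 + C0) + measure M (space M) * s0 powr \<beta>"
  have "c > 0" using A_pos C0 by (auto simp: c_def intro!: add_pos_nonneg)
  show thesis
  proof
    show "c * \<beta> / (\<beta> - q) > 0" using \<open>c > 0\<close> assms beta by auto
    fix x \<sigma> assume x: "x \<in> space N" and "1 \<le> (\<sigma>::real)"
    have "emeasure M {y\<in>space M. k x y > s} \<le> ennreal (c * s powr (-\<beta>))" if "1 \<le> s" for s
      unfolding c_def
    proof (rule extend_tail)
      fix s assume "s0 \<le> s"
      have "A * s powr (-\<beta>) * (1 + C0 * ln s powr (-\<gamma>)) \<le> A * s powr (-\<beta>) * (1 + C0 * 1)"
        using log_correction_le[OF \<open>s0 \<le> s\<close>] A_pos C0 by (intro mult_left_mono add_left_mono) auto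
      then show "emeasure M {y \<in> space M. s < k x y} \<le> ennreal (A * (1 + C0) * s powr - \<beta>)"
        using tail1[OF x \<open>s0 \<le> s\<close>] by (elim order_trans) (auto intro!: ennreal_leI simp: mult_ac)
    qed (use beta A_pos C0 that in \<open>auto intro: M.finite_measure_axioms\<close>)
    then show "(\<integral>\<^sup>+y. ennreal (k x y powr q) * indicator {y. k x y > \<sigma>} y \<partial>M)
        \<le> ennreal (c * \<beta> / (\<beta> - q) * \<sigma> powr (q - \<beta>))"
      using assms \<open>1 \<le> \<sigma>\<close> \<open>c > 0\<close> x
      by (intro nn_integral_powr_tail_le M.finite_measure_axioms) auto
  qed
qed

lemma tail_moment2:
  assumes "0 < q" "q < \<beta>0"
  obtains c where "c > 0" "\<And>y \<sigma>. y \<in> space M \<Longrightarrow> 1 \<le> \<sigma> \<Longrightarrow>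
    (\<integral>\<^sup>+x. ennreal (k x y powr q) * indicator {x. k x y > \<sigma>} x \<partial>N) \<le> ennreal (c * \<sigma> powr (q - \<beta>0))"
proof -
  define c where "c = B + measure N (space N) * s0 powr \<beta>0"
  have "c > 0" using B_pos by (auto simp: c_def intro!: add_pos_nonneg)
  show thesis
  proof
    show "c * \<beta>0 / (\<beta>0 - q) > 0" using \<open>c > 0\<close> assms beta0 by auto
    fix y \<sigma> assume y: "y \<in> space M" and "1 \<le> (\<sigma>::real)"
    have "emeasure N {x\<in>space N. k x y > s} \<le> ennreal (c * s powr (-\<beta>0))" if "1 \<le> s" for s
      unfolding c_def
      by (rule extend_tail) (use beta0 B_pos that tail2[OF y] in \<open>auto intro: N.finite_measure_axioms\<close>)
    then show "(\<integral>\<^sup>+x. ennreal (k x y powr q) * indicator {x. k x y > \<sigma>} x \<partial>N)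
        \<le> ennreal (c * \<beta>0 / (\<beta>0 - q) * \<sigma> powr (q - \<beta>0))"
      using assms \<open>1 \<le> \<sigma>\<close> \<open>c > 0\<close> y
      by (intro nn_integral_powr_tail_le N.finite_measure_axioms) auto
  qed
qed

text \<open>This is the borderline exponent q = \<beta>, where the layer-cake integrand becomes A
  \<beta> (1/s + C0 (ln s)^(-\<gamma>) / s). The first term yields the logarithm with the sharp
  constant; the second has a bounded primitive because \<gamma> > 1.\<close>

lemma band_moment_large:
  assumes x: "x \<in> space N" and \<sigma>: "s0 \<le> \<sigma>1" "\<sigma>1 \<le> \<sigma>2"
  shows "(\<integral>\<^sup>+y. ennreal (k x y powr \<beta>) * indicator {y. \<sigma>1 < k x y \<and> k x y \<le> \<sigma>2} y \<partial>M)
    \<le> ennreal (A * \<beta> * ln (\<sigma>2 / \<sigma>1) + (A * (1 + C0) + A * \<beta> * C0 / (\<gamma> - 1)))"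
proof -
  \<comment> \<open>Truncating k at \<sigma>2 empties the superlevel sets from \<sigma>2 on, so the
    layer-cake integral stops there.\<close>
  let ?h = "\<lambda>y. min (k x y) \<sigma>2"
  define \<Psi> where "\<Psi> s = A * \<beta> * (ln s - C0 / (\<gamma> - 1) * ln s powr (1 - \<gamma>))" for s
  have pos: "\<sigma>1 > 0" "\<sigma>2 > 0" using \<sigma> s0_ge by auto
  have D: "emeasure M {y\<in>space M. k x y > s} \<le> ennreal (A * s powr (-\<beta>) * (1 + C0 * ln s powr (-\<gamma>)))"
    if "\<sigma>1 \<le> s" for s using tail1[OF x] that \<sigma> by auto
  have "(\<integral>\<^sup>+y. ennreal (k x y powr \<beta>) * indicator {y. \<sigma>1 < k x y \<and> k x y \<le> \<sigma>2} y \<partial>M)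
    \<le> (\<integral>\<^sup>+y. ennreal (?h y powr \<beta>) * indicator {y. ?h y > \<sigma>1} y \<partial>M)"
  proof (cases "\<sigma>1 = \<sigma>2")
    case True
    then have "{y. \<sigma>1 < k x y \<and> k x y \<le> \<sigma>2} = {}" by auto
    then show ?thesis by simp
  next
    case False
    then show ?thesis using \<sigma> by (auto intro!: nn_integral_mono simp: indicator_def)
  qed
  also have "(\<integral>\<^sup>+y. ennreal (?h y powr \<beta>) * indicator {y. ?h y > \<sigma>1} y \<partial>M) =
     ennreal (\<sigma>1 powr \<beta>) * emeasure M {y\<in>space M. ?h y > \<sigma>1} +
    (\<integral>\<^sup>+s. ennreal (\<beta> * s powr (\<beta> - 1)) * indicator {\<sigma>1..} s * emeasure M {y\<in>space M. ?h y > s} \<partial>lborel)"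
    using x beta pos by (intro nn_integral_powr_layer_cake) (auto intro: M.finite_measure_axioms)
  also have "(\<integral>\<^sup>+s. ennreal (\<beta> * s powr (\<beta> - 1)) * indicator {\<sigma>1..} s * emeasure M {y\<in>space M. ?h y > s} \<partial>lborel)
     \<le> (\<integral>\<^sup>+s. ennreal (A * \<beta> * (1 / s + C0 * (ln s powr (-\<gamma>) / s))) * indicator {\<sigma>1..\<sigma>2} s \<partial>lborel)"
  proof (intro nn_integral_mono)
    fix s :: real
    show "ennreal (\<beta> * s powr (\<beta> - 1)) * indicator {\<sigma>1..} s * emeasure M {y\<in>space M. ?h y > s}
       \<le> ennreal (A * \<beta> * (1 / s + C0 * (ln s powr (-\<gamma>) / s))) * indicator {\<sigma>1..\<sigma>2} s"
    proof (cases "\<sigma>1 \<le> s \<and> s < \<sigma>2")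
      case True
      then have "s > 0" using pos by auto
      have "ennreal (\<beta> * s powr (\<beta> - 1)) * emeasure M {y\<in>space M. ?h y > s}
          = ennreal (\<beta> * s powr (\<beta> - 1)) * emeasure M {y\<in>space M. k x y > s}"
        using True by (auto intro!: arg_cong[where f = "emeasure M"])
      also have "\<dots> \<le> ennreal (\<beta> * s powr (\<beta> - 1)) * ennreal (A * s powr (-\<beta>) * (1 + C0 * ln s powr (-\<gamma>)))"
        using D True by (intro mult_left_mono) auto
      also have "\<dots> = ennreal (A * \<beta> * (s powr (\<beta> - 1) * s powr (-\<beta>)) * (1 + C0 * ln s powr (-\<gamma>)))"
        using beta by (subst ennreal_mult'[symmetric]) (auto simp: mult_ac)
      also have "s powr (\<beta> - 1) * s powr (-\<beta>) = 1 / s"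
        using \<open>s > 0\<close> by (simp flip: powr_add)
      finally show ?thesis using True by (simp add: algebra_simps add_divide_distrib)
    next
      case False
      then have "s < \<sigma>1 \<or> emeasure M {y\<in>space M. ?h y > s} = 0"
        by (cases "s < \<sigma>1") (auto intro!: arg_cong[where f = "emeasure M" and y = "{}", simplified])
      then show ?thesis by (elim disjE) simp_all
    qed
  qed
  also have "\<dots> = ennreal (\<Psi> \<sigma>2 - \<Psi> \<sigma>1)"
  proof (intro nn_integral_FTC_Icc)
    fix s assume "s \<in> {\<sigma>1..\<sigma>2}"
    then have "\<sigma>1 \<le> s" by simp
    have "s > 0" using \<open>\<sigma>1 \<le> s\<close> pos by simp
    moreover have "ln s \<ge> 1" using \<open>\<sigma>1 \<le> s\<close> \<sigma> by (intro ln_ge_1) simp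
    ultimately have s: "s > 0" "ln s > 0" by linarith+
    have "(\<Psi> has_real_derivative A * \<beta> * (1 / s - C0 / (\<gamma> - 1) * ((1 - \<gamma>) * ln s powr (1 - \<gamma> - 1) * (1 / s)))) (at s)"
      unfolding \<Psi>_def using s
      by (intro DERIV_cmult DERIV_diff DERIV_chain2[OF has_real_derivative_powr]) (auto intro!: derivative_eq_intros)
    also have "A * \<beta> * (1 / s - C0 / (\<gamma> - 1) * ((1 - \<gamma>) * ln s powr (1 - \<gamma> - 1) * (1 / s)))
       = A * \<beta> * (1 / s + C0 * (ln s powr (-\<gamma>) / s))"
      using gamma s by (simp add: divide_simps) (simp add: algebra_simps)
    finally show "(\<Psi> has_real_derivative A * \<beta> * (1 / s + C0 * (ln s powr - \<gamma> / s))) (at s)" .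
    show "0 \<le> A * \<beta> * (1 / s + C0 * (ln s powr - \<gamma> / s))"
      using s A_pos beta C0 by auto
  qed (use \<sigma> in auto)
  also have "ennreal (\<sigma>1 powr \<beta>) * emeasure M {y\<in>space M. ?h y > \<sigma>1} \<le> ennreal (A * (1 + C0))"
  proof -
    have "emeasure M {y\<in>space M. ?h y > \<sigma>1} \<le> emeasure M {y\<in>space M. k x y > \<sigma>1}"
      using x by (intro emeasure_mono) auto
    also note D[OF order_refl]
    finally have "ennreal (\<sigma>1 powr \<beta>) * emeasure M {y\<in>space M. ?h y > \<sigma>1}
      \<le> ennreal (\<sigma>1 powr \<beta>) * ennreal (A * \<sigma>1 powr (-\<beta>) * (1 + C0 * ln \<sigma>1 powr (-\<gamma>)))"
      by (intro mult_left_mono) auto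
    also have "\<dots> = ennreal (A * (1 + C0 * ln \<sigma>1 powr (-\<gamma>)))"
    proof -
      have "\<sigma>1 powr \<beta> * \<sigma>1 powr (-\<beta>) = 1" using pos by (simp flip: powr_add)
      then have "\<sigma>1 powr \<beta> * (A * \<sigma>1 powr (-\<beta>) * Z) = A * Z" for Z
        by (metis mult.assoc mult.commute mult_1)
      then show ?thesis by (simp only: ennreal_mult'[symmetric] powr_ge_zero)
    qed
    also have "\<dots> \<le> ennreal (A * (1 + C0 * 1))"
      using log_correction_le[OF \<sigma>(1)] A_pos C0 by (intro ennreal_leI mult_left_mono add_left_mono) auto
    finally show ?thesis by simp
  qed
  finally have "(\<integral>\<^sup>+y. ennreal (k x y powr \<beta>) * indicator {y. \<sigma>1 < k x y \<and> k x y \<le> \<sigma>2} y \<partial>M)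
     \<le> ennreal (A * (1 + C0)) + ennreal (\<Psi> \<sigma>2 - \<Psi> \<sigma>1)"
    by (simp add: add_mono)
  also have "\<dots> \<le> ennreal (A * (1 + C0)) + ennreal (A * \<beta> * ln (\<sigma>2 / \<sigma>1) + A * \<beta> * C0 / (\<gamma> - 1))"
  proof (intro add_left_mono ennreal_leI)
    have "ln \<sigma>1 powr (1 - \<gamma>) \<le> 1"
      using ln_ge_1[OF \<sigma>(1)] gamma powr_mono2'[of "1 - \<gamma>" 1 "ln \<sigma>1"] by auto
    then have "ln \<sigma>1 powr (1 - \<gamma>) - ln \<sigma>2 powr (1 - \<gamma>) \<le> 1"
      by (smt (verit) powr_ge_zero)
    then have "A * \<beta> * (C0 / (\<gamma> - 1) * (ln \<sigma>1 powr (1 - \<gamma>) - ln \<sigma>2 powr (1 - \<gamma>))) \<le> A * \<beta> * (C0 / (\<gamma> - 1) * 1)"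
      using A_pos beta C0 gamma by (intro mult_left_mono) auto
    then show "\<Psi> \<sigma>2 - \<Psi> \<sigma>1 \<le> A * \<beta> * ln (\<sigma>2 / \<sigma>1) + A * \<beta> * C0 / (\<gamma> - 1)"
      using pos by (simp add: \<Psi>_def ln_div) (simp add: algebra_simps diff_divide_distrib)
  qed
  also have "\<dots> = ennreal (A * \<beta> * ln (\<sigma>2 / \<sigma>1) + (A * (1 + C0) + A * \<beta> * C0 / (\<gamma> - 1)))"
    using A_pos beta C0 gamma \<sigma> pos by (subst ennreal_plus[symmetric]) (auto simp: add_ac)
  finally show ?thesis .
qed

text \<open>The region k \<le> s0 has \<beta>-th moment at most s0^\<beta> times the total mass.
  Adding this constant frees the estimate from the threshold s0 without touching the coefficient A
  \<beta> of the logarithm.\<close>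

lemma band_moment:
  obtains C where "C > 0"
    "\<And>x \<sigma>1 \<sigma>2. x \<in> space N \<Longrightarrow> 1 \<le> \<sigma>1 \<Longrightarrow> \<sigma>1 \<le> \<sigma>2 \<Longrightarrow>
      (\<integral>\<^sup>+y. ennreal (k x y powr \<beta>) * indicator {y. \<sigma>1 < k x y \<and> k x y \<le> \<sigma>2} y \<partial>M)
      \<le> ennreal (A * \<beta> * ln (\<sigma>2 / \<sigma>1) + C)"
    "\<And>x \<sigma>. x \<in> space N \<Longrightarrow> 1 \<le> \<sigma> \<Longrightarrow>
      (\<integral>\<^sup>+y. ennreal (k x y powr \<beta>) * indicator {y. k x y \<le> \<sigma>} y \<partial>M) \<le> ennreal (A * \<beta> * ln \<sigma> + C)"
proof -
  define D where "D = A * (1 + C0) + A * \<beta> * C0 / (\<gamma> - 1)"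
  have "D > 0" unfolding D_def using A_pos C0 beta gamma by (intro add_pos_nonneg) auto
  define m where "m = measure M (space M)"
  have "m \<ge> 0" by (simp add: m_def)
  have small: "(\<integral>\<^sup>+y. ennreal (k x y powr \<beta>) * indicator {y. k x y \<le> s0} y \<partial>M) \<le> ennreal (s0 powr \<beta> * m)" for x
  proof -
    have "(\<integral>\<^sup>+y. ennreal (k x y powr \<beta>) * indicator {y. k x y \<le> s0} y \<partial>M) \<le> (\<integral>\<^sup>+y. ennreal (s0 powr \<beta>) \<partial>M)"
      using k_nonneg beta by (intro nn_integral_mono) (auto simp: indicator_def intro!: ennreal_leI powr_mono2)
    also have "\<dots> = ennreal (s0 powr \<beta> * m)"
      by (simp add: M.emeasure_eq_measure m_def ennreal_mult)
    finally show ?thesis .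
  qed
  have band: "(\<integral>\<^sup>+y. ennreal (k x y powr \<beta>) * indicator {y. \<sigma>1 < k x y \<and> k x y \<le> \<sigma>2} y \<partial>M)
      \<le> ennreal (A * \<beta> * ln (\<sigma>2 / \<sigma>1) + (D + s0 powr \<beta> * m))"
    if [measurable]: "x \<in> space N" and \<sigma>: "1 \<le> \<sigma>1" "\<sigma>1 \<le> \<sigma>2" for x \<sigma>1 \<sigma>2
  proof -
    \<comment> \<open>Raising both levels to at least s0 does not increase their ratio, so the
      logarithm does not grow.\<close>
    define \<tau>1 \<tau>2 where "\<tau>1 = max s0 \<sigma>1" and "\<tau>2 = max s0 \<sigma>2"
    have "(\<integral>\<^sup>+y. ennreal (k x y powr \<beta>) * indicator {y. \<sigma>1 < k x y \<and> k x y \<le> \<sigma>2} y \<partial>M)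
       \<le> (\<integral>\<^sup>+y. ennreal (k x y powr \<beta>) * indicator {y. k x y \<le> s0} y
           + ennreal (k x y powr \<beta>) * indicator {y. \<tau>1 < k x y \<and> k x y \<le> \<tau>2} y \<partial>M)"
      by (intro nn_integral_mono) (auto simp: \<tau>1_def \<tau>2_def indicator_def)
    also have "\<dots> = (\<integral>\<^sup>+y. ennreal (k x y powr \<beta>) * indicator {y. k x y \<le> s0} y \<partial>M)
        + (\<integral>\<^sup>+y. ennreal (k x y powr \<beta>) * indicator {y. \<tau>1 < k x y \<and> k x y \<le> \<tau>2} y \<partial>M)"
      by (rule nn_integral_add) measurable
    also have "\<dots> \<le> ennreal (s0 powr \<beta> * m) + ennreal (A * \<beta> * ln (\<tau>2 / \<tau>1) + D)"
      unfolding D_def using that \<tau>1_def \<tau>2_def by (intro add_mono small band_moment_large) auto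
    also have "\<dots> \<le> ennreal (s0 powr \<beta> * m) + ennreal (A * \<beta> * ln (\<sigma>2 / \<sigma>1) + D)"
    proof (intro add_left_mono ennreal_leI add_right_mono mult_left_mono)
      have "\<tau>2 / \<tau>1 \<le> \<sigma>2 / \<sigma>1"
        using \<sigma> s0_ge by (auto simp: \<tau>1_def \<tau>2_def max_def field_simps intro: mult_mono)
      then show "ln (\<tau>2 / \<tau>1) \<le> ln (\<sigma>2 / \<sigma>1)"
        using \<sigma> s0_ge by (subst ln_le_cancel_iff) (auto simp: \<tau>1_def \<tau>2_def)
    qed (use A_pos beta in auto)
    also have "\<dots> = ennreal (A * \<beta> * ln (\<sigma>2 / \<sigma>1) + (D + s0 powr \<beta> * m))"
      using \<open>D > 0\<close> \<open>m \<ge> 0\<close> A_pos beta \<sigma> by (subst ennreal_plus[symmetric]) (auto simp: add_ac)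
    finally show ?thesis .
  qed
  have low: "(\<integral>\<^sup>+y. ennreal (k x y powr \<beta>) * indicator {y. k x y \<le> \<sigma>} y \<partial>M)
      \<le> ennreal (A * \<beta> * ln \<sigma> + (D + 2 * s0 powr \<beta> * m))"
    if [measurable]: "x \<in> space N" and \<sigma>: "1 \<le> \<sigma>" for x \<sigma>
  proof -
    have "(\<integral>\<^sup>+y. ennreal (k x y powr \<beta>) * indicator {y. k x y \<le> \<sigma>} y \<partial>M)
       \<le> (\<integral>\<^sup>+y. ennreal (k x y powr \<beta>) * indicator {y. k x y \<le> s0} y
           + ennreal (k x y powr \<beta>) * indicator {y. 1 < k x y \<and> k x y \<le> \<sigma>} y \<partial>M)"
      using s0_ge by (intro nn_integral_mono) (auto simp: indicator_def)
    also have "\<dots> = (\<integral>\<^sup>+y. ennreal (k x y powr \<beta>) * indicator {y. k x y \<le> s0} y \<partial>M)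
        + (\<integral>\<^sup>+y. ennreal (k x y powr \<beta>) * indicator {y. 1 < k x y \<and> k x y \<le> \<sigma>} y \<partial>M)"
      by (rule nn_integral_add) measurable
    also have "\<dots> \<le> ennreal (s0 powr \<beta> * m) + ennreal (A * \<beta> * ln (\<sigma> / 1) + (D + s0 powr \<beta> * m))"
      using that by (intro add_mono small band) auto
    also have "\<dots> = ennreal (A * \<beta> * ln \<sigma> + (D + 2 * s0 powr \<beta> * m))"
      using \<open>D > 0\<close> \<open>m \<ge> 0\<close> A_pos beta \<sigma> by (subst ennreal_plus[symmetric]) (auto simp: add_ac)
    finally show ?thesis .
  qed
  show thesis
  proof
    show "D + 2 * s0 powr \<beta> * m > 0" using \<open>D > 0\<close> \<open>m \<ge> 0\<close> by (auto intro: add_pos_nonneg)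
    show "(\<integral>\<^sup>+y. ennreal (k x y powr \<beta>) * indicator {y. \<sigma>1 < k x y \<and> k x y \<le> \<sigma>2} y \<partial>M)
      \<le> ennreal (A * \<beta> * ln (\<sigma>2 / \<sigma>1) + (D + 2 * s0 powr \<beta> * m))"
      if "x \<in> space N" and \<sigma>: "1 \<le> \<sigma>1" "\<sigma>1 \<le> \<sigma>2" for x \<sigma>1 \<sigma>2
      using band[OF that] \<open>m \<ge> 0\<close> by (elim order_trans) (auto intro!: ennreal_leI)
  qed (use low in auto)
qed


section \<open>Schur test above the cut level\<close>

definition p where "p = \<beta> / (\<beta> - 1)"

lemma p: "p > 1" "1 / p + 1 / \<beta> = 1" "1 / \<beta> + 1 / p = 1" "\<beta> / p = \<beta> - 1"
  using beta by (auto simp: p_def field_simps)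

text \<open>Both conclusions share the exponent \<open>a\<close>, so they are obtained together:
  Hoelder in y for fixed x, and Tonelli over x for the quantity that the first leaves open. The
  conditions a p < \<beta>0 and 0 < (1-a) \<beta> < \<beta> are what the tail moments in x and in y
  require.\<close>

lemma tail_pointwise:
  obtains a c where "0 < a" "0 < c"
    "\<And>x \<sigma> h Y. \<lbrakk>x \<in> space N; 1 \<le> \<sigma>; h \<in> borel_measurable M; \<And>y. 0 \<le> h y; 0 \<le> Y;
      (\<integral>\<^sup>+y. ennreal (k x y powr (a * p) * h y powr p) * indicator {y. k x y > \<sigma>} y \<partial>M) \<le> ennreal Y\<rbrakk> \<Longrightarrow>
      (\<integral>\<^sup>+y. ennreal (k x y * h y) * indicator {y. k x y > \<sigma>} y \<partial>M) \<le> ennreal (c * \<sigma> powr (-a) * Y powr (1/p))"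
    "\<And>\<sigma> h. \<lbrakk>1 \<le> \<sigma>; h \<in> borel_measurable M\<rbrakk> \<Longrightarrow>
      (\<integral>\<^sup>+x. (\<integral>\<^sup>+y. ennreal (k x y powr (a * p) * h y powr p) * indicator {y. k x y > \<sigma>} y \<partial>M) \<partial>N)
      \<le> ennreal (c * \<sigma> powr (a * p - \<beta>0)) * (\<integral>\<^sup>+y. ennreal (h y powr p) \<partial>M)"
proof -
  \<comment> \<open>Hoelder is applied to $k = k^a k^{1-a}$; both factors keep a finite tail moment, one in each variable.\<close>
  define a where "a = min (\<beta>0 / p) 1 / 2"
  have a: "0 < a" "a < 1"
  proof -
    have "0 < \<beta>0 / p" using beta0 p by simp
    then show "0 < a" unfolding a_def by simp
    have "a \<le> 1 / 2" by (simp add: a_def)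
    then show "a < 1" by linarith
  qed
  have "a < \<beta>0 / p"
  proof -
    have "min t 1 / 2 < t" if "0 < t" for t :: real using that by (auto simp: min_def)
    from this[of "\<beta>0 / p"] show ?thesis unfolding a_def using beta0 p by simp
  qed
  then have ap: "0 < a * p" "a * p < \<beta>0" using a p by (auto simp: field_simps)
  have ab: "0 < (1 - a) * \<beta>" "(1 - a) * \<beta> < \<beta>" using a beta by auto
  obtain c1 where c1: "c1 > 0" "\<And>x \<sigma>. x \<in> space N \<Longrightarrow> 1 \<le> \<sigma> \<Longrightarrow>
    (\<integral>\<^sup>+y. ennreal (k x y powr ((1 - a) * \<beta>)) * indicator {y. k x y > \<sigma>} y \<partial>M)
      \<le> ennreal (c1 * \<sigma> powr ((1 - a) * \<beta> - \<beta>))"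
    using tail_moment1[OF ab] by blast
  obtain c2 where c2: "c2 > 0" "\<And>y \<sigma>. y \<in> space M \<Longrightarrow> 1 \<le> \<sigma> \<Longrightarrow>
    (\<integral>\<^sup>+x. ennreal (k x y powr (a * p)) * indicator {x. k x y > \<sigma>} x \<partial>N) \<le> ennreal (c2 * \<sigma> powr (a * p - \<beta>0))"
    using tail_moment2[OF ap] by blast
  define c where "c = c2 + c1 powr (1 / \<beta>)"
  have c: "c > 0" "c2 \<le> c" "c1 powr (1 / \<beta>) \<le> c" using c1 c2 by (auto simp: c_def add_pos_nonneg)
  show thesis
  proof (rule that[OF a(1) c(1)])
    fix x \<sigma> Y and h :: "'a \<Rightarrow> real"
    assume [measurable]: "x \<in> space N" and "1 \<le> \<sigma>" and [measurable]: "h \<in> borel_measurable M" and h: "\<And>y. 0 \<le> h y" and "0 \<le> Y"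
      and le: "(\<integral>\<^sup>+y. ennreal (k x y powr (a * p) * h y powr p) * indicator {y. k x y > \<sigma>} y \<partial>M) \<le> ennreal Y"
    define F where "F y = k x y powr a * h y * indicator {y. k x y > \<sigma>} y" for y
    define G where "G y = k x y powr (1 - a) * indicator {y. k x y > \<sigma>} y" for y
    have [measurable]: "F \<in> borel_measurable M" "G \<in> borel_measurable M"
      unfolding F_def G_def by measurable
    have "(\<integral>\<^sup>+y. ennreal (k x y * h y) * indicator {y. k x y > \<sigma>} y \<partial>M) = (\<integral>\<^sup>+y. ennreal (F y * G y) \<partial>M)"
      using \<open>1 \<le> \<sigma>\<close> a
      by (intro nn_integral_cong) (auto simp: F_def G_def indicator_def mult.commute mult.left_commute simp flip: powr_add)
    also have "\<dots> \<le> ennreal (Y powr (1/p) * (c1 * \<sigma> powr ((1 - a) * \<beta> - \<beta>)) powr (1/\<beta>))"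
    proof (rule nn_integral_Holder)
      have "(\<integral>\<^sup>+y. ennreal (F y powr p) \<partial>M) =
          (\<integral>\<^sup>+y. ennreal (k x y powr (a * p) * h y powr p) * indicator {y. k x y > \<sigma>} y \<partial>M)"
        using h by (intro nn_integral_cong) (auto simp: F_def indicator_def powr_mult powr_powr)
      then show "(\<integral>\<^sup>+y. ennreal (F y powr p) \<partial>M) \<le> ennreal Y" using le by simp
      have "(\<integral>\<^sup>+y. ennreal (G y powr \<beta>) \<partial>M) =
          (\<integral>\<^sup>+y. ennreal (k x y powr ((1 - a) * \<beta>)) * indicator {y. k x y > \<sigma>} y \<partial>M)"
        by (intro nn_integral_cong) (auto simp: G_def indicator_def powr_powr)
      then show "(\<integral>\<^sup>+y. ennreal (G y powr \<beta>) \<partial>M) \<le> ennreal (c1 * \<sigma> powr ((1 - a) * \<beta> - \<beta>))"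
        using c1(2)[of x \<sigma>] \<open>x \<in> space N\<close> \<open>1 \<le> \<sigma>\<close> by simp
    qed (use p beta c1 \<open>0 \<le> Y\<close> h in \<open>auto simp: F_def G_def\<close>)
    also have "\<dots> \<le> ennreal (c * \<sigma> powr (-a) * Y powr (1/p))"
    proof (intro ennreal_leI)
      have "(c1 * \<sigma> powr ((1 - a) * \<beta> - \<beta>)) powr (1/\<beta>) = c1 powr (1/\<beta>) * \<sigma> powr (-a)"
        using c1 beta \<open>1 \<le> \<sigma>\<close> by (simp add: powr_mult powr_powr) (simp add: field_simps)
      also have "\<dots> \<le> c * \<sigma> powr (-a)" using c by (intro mult_right_mono) auto
      finally have "(c1 * \<sigma> powr ((1 - a) * \<beta> - \<beta>)) powr (1/\<beta>) * Y powr (1/p) \<le> c * \<sigma> powr (-a) * Y powr (1/p)"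
        by (intro mult_right_mono) auto
      then show "Y powr (1/p) * (c1 * \<sigma> powr ((1 - a) * \<beta> - \<beta>)) powr (1/\<beta>) \<le> c * \<sigma> powr (-a) * Y powr (1/p)"
        by (simp add: mult.commute)
    qed
    finally show "(\<integral>\<^sup>+y. ennreal (k x y * h y) * indicator {y. k x y > \<sigma>} y \<partial>M) \<le> ennreal (c * \<sigma> powr (-a) * Y powr (1/p))" .
  next
    fix \<sigma> :: real and h :: "'a \<Rightarrow> real" assume "1 \<le> \<sigma>" and [measurable]: "h \<in> borel_measurable M"
    interpret pair_sigma_finite M N by unfold_locales
    define G where "G y x = ennreal (k x y powr (a * p) * h y powr p) * indicator {y. k x y > \<sigma>} y" for y x
    have [measurable]: "case_prod G \<in> borel_measurable (M \<Otimes>\<^sub>M N)"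
      unfolding G_def indicator_def by measurable
    have "(\<integral>\<^sup>+x. (\<integral>\<^sup>+y. G y x \<partial>M) \<partial>N) = (\<integral>\<^sup>+y. (\<integral>\<^sup>+x. G y x \<partial>N) \<partial>M)"
      by (intro Fubini') measurable
    also have "\<dots> \<le> (\<integral>\<^sup>+y. ennreal (c * \<sigma> powr (a * p - \<beta>0)) * ennreal (h y powr p) \<partial>M)"
    proof (intro nn_integral_mono)
      fix y assume [measurable]: "y \<in> space M"
      have "(\<integral>\<^sup>+x. G y x \<partial>N) = (\<integral>\<^sup>+x. ennreal (h y powr p) * (ennreal (k x y powr (a * p)) * indicator {x. k x y > \<sigma>} x) \<partial>N)"
        by (intro nn_integral_cong) (auto simp: G_def indicator_def mult.commute ennreal_mult)
      also have "\<dots> = ennreal (h y powr p) * (\<integral>\<^sup>+x. ennreal (k x y powr (a * p)) * indicator {x. k x y > \<sigma>} x \<partial>N)"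
        by (rule nn_integral_cmult) measurable
      also have "\<dots> \<le> ennreal (h y powr p) * ennreal (c2 * \<sigma> powr (a * p - \<beta>0))"
        using c2(2)[OF \<open>y \<in> space M\<close> \<open>1 \<le> \<sigma>\<close>] by (intro mult_left_mono) auto
      also have "\<dots> \<le> ennreal (h y powr p) * ennreal (c * \<sigma> powr (a * p - \<beta>0))"
        using c by (intro mult_left_mono ennreal_leI mult_right_mono) auto
      finally show "(\<integral>\<^sup>+x. G y x \<partial>N) \<le> ennreal (c * \<sigma> powr (a * p - \<beta>0)) * ennreal (h y powr p)"
        by (simp add: mult.commute)
    qed
    also have "\<dots> = ennreal (c * \<sigma> powr (a * p - \<beta>0)) * (\<integral>\<^sup>+y. ennreal (h y powr p) \<partial>M)"
      by (rule nn_integral_cmult) measurable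
    finally show "(\<integral>\<^sup>+x. (\<integral>\<^sup>+y. ennreal (k x y powr (a * p) * h y powr p) * indicator {y. k x y > \<sigma>} y \<partial>M) \<partial>N)
      \<le> ennreal (c * \<sigma> powr (a * p - \<beta>0)) * (\<integral>\<^sup>+y. ennreal (h y powr p) \<partial>M)" by (simp add: G_def)
  qed
qed

text \<open>On a set of measure \<sigma>^(-\<beta>0) the inner integral of the Schur test is at some
  point at most its average, O(\<sigma>^(a p) m). Its p-th root cancels the factor \<sigma>^(-a), so
  the bound does not depend on \<sigma>. One good point is enough, since the lower bound it will be
  compared with holds on all of E.\<close>

lemma tail_good_point:
  obtains c where "0 < c"
    "\<And>\<sigma> h m E. \<lbrakk>1 \<le> \<sigma>; h \<in> borel_measurable M; \<And>y. 0 \<le> h y; 0 \<le> m;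
      (\<integral>\<^sup>+y. ennreal (h y powr p) \<partial>M) \<le> ennreal m;
      E \<in> sets N; ennreal (\<sigma> powr (-\<beta>0)) \<le> emeasure N E\<rbrakk> \<Longrightarrow>
      \<exists>x\<in>E. (\<integral>\<^sup>+y. ennreal (k x y * h y) * indicator {y. k x y > \<sigma>} y \<partial>M) \<le> ennreal (c * m powr (1/p))"
proof (rule tail_pointwise)
  fix a c :: real assume a: "0 < a" and c: "0 < c"
  assume pw: "\<And>x \<sigma> h Y. \<lbrakk>x \<in> space N; 1 \<le> \<sigma>; h \<in> borel_measurable M; \<And>y. 0 \<le> h y; 0 \<le> Y;
      (\<integral>\<^sup>+y. ennreal (k x y powr (a * p) * h y powr p) * indicator {y. k x y > \<sigma>} y \<partial>M) \<le> ennreal Y\<rbrakk> \<Longrightarrow>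
      (\<integral>\<^sup>+y. ennreal (k x y * h y) * indicator {y. k x y > \<sigma>} y \<partial>M) \<le> ennreal (c * \<sigma> powr (-a) * Y powr (1/p))"
  assume int: "\<And>\<sigma> h. \<lbrakk>1 \<le> \<sigma>; h \<in> borel_measurable M\<rbrakk> \<Longrightarrow>
      (\<integral>\<^sup>+x. (\<integral>\<^sup>+y. ennreal (k x y powr (a * p) * h y powr p) * indicator {y. k x y > \<sigma>} y \<partial>M) \<partial>N)
      \<le> ennreal (c * \<sigma> powr (a * p - \<beta>0)) * (\<integral>\<^sup>+y. ennreal (h y powr p) \<partial>M)"
  show thesis
  proof (rule that)
    show "0 < c * c powr (1/p)" using c by simp
    fix \<sigma> m :: real and h :: "'a \<Rightarrow> real" and E
    assume \<sigma>: "1 \<le> \<sigma>" and h[measurable]: "h \<in> borel_measurable M" and nonneg: "\<And>y. 0 \<le> h y" and m: "0 \<le> m"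
      and hm: "(\<integral>\<^sup>+y. ennreal (h y powr p) \<partial>M) \<le> ennreal m"
      and E[measurable]: "E \<in> sets N" and big: "ennreal (\<sigma> powr (-\<beta>0)) \<le> emeasure N E"
    define J where "J x = (\<integral>\<^sup>+y. ennreal (k x y powr (a * p) * h y powr p) * indicator {y. k x y > \<sigma>} y \<partial>M)" for x
    have [measurable]: "J \<in> borel_measurable N" unfolding J_def indicator_def by measurable
    \<comment> \<open>The bound c \<sigma>^(a p - \<beta>0) m for the integral of \<open>J\<close>,
      divided by the least admissible measure \<sigma>^(-\<beta>0) of E.\<close>
    define Y where "Y = c * \<sigma> powr (a * p) * m"
    have "0 \<le> Y" using c m by (simp add: Y_def)
    have "\<exists>x\<in>E. J x \<le> ennreal Y"
    proof (rule ccontr)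
      assume "\<not> ?thesis"
      then have less: "x \<in> E \<Longrightarrow> ennreal Y < J x" for x by (auto simp: not_le)
      \<comment> \<open>The inequality must be strict to produce a contradiction; it is, because E
        has positive measure. This also covers m = 0, where Y = 0.\<close>
      have "(\<integral>\<^sup>+x. ennreal Y * indicator E x \<partial>N) < (\<integral>\<^sup>+x. J x * indicator E x \<partial>N)"
      proof (rule nn_integral_less)
        have "(\<integral>\<^sup>+x. ennreal Y * indicator E x \<partial>N) = ennreal Y * emeasure N E" by (simp add: nn_integral_cmult)
        then show "(\<integral>\<^sup>+x. ennreal Y * indicator E x \<partial>N) \<noteq> \<infinity>"
          by (simp add: N.emeasure_eq_measure ennreal_mult_eq_top_iff)
        show "AE x in N. ennreal Y * indicator E x \<le> J x * indicator E x"
          using less by (auto simp: indicator_def intro: less_imp_le)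
        show "\<not> (AE x in N. J x * indicator E x \<le> ennreal Y * indicator E x)"
        proof
          assume "AE x in N. J x * indicator E x \<le> ennreal Y * indicator E x"
          then have "AE x in N. x \<notin> E" by eventually_elim (use less in \<open>auto simp: not_less[symmetric]\<close>)
          then have "emeasure N E = 0" using E by (simp add: AE_iff_measurable[OF _ refl] Int_def[symmetric] Collect_conj_eq sets.sets_into_space Int_absorb1)
          then show False using big \<sigma> by (simp add: ennreal_eq_0_iff)
        qed
      qed measurable
      also have "\<dots> \<le> (\<integral>\<^sup>+x. J x \<partial>N)" by (intro nn_integral_mono) (auto simp: indicator_def)
      also have "\<dots> \<le> ennreal (c * \<sigma> powr (a * p - \<beta>0)) * (\<integral>\<^sup>+y. ennreal (h y powr p) \<partial>M)"
        unfolding J_def using int[OF \<sigma> h] .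
      also have "\<dots> \<le> ennreal (c * \<sigma> powr (a * p - \<beta>0)) * ennreal m" using hm by (intro mult_left_mono) auto
      also have "\<dots> = ennreal Y * ennreal (\<sigma> powr (-\<beta>0))"
        using c m \<sigma> by (simp add: Y_def powr_add[symmetric] mult_ac flip: ennreal_mult)
      also have "\<dots> \<le> ennreal Y * emeasure N E" using big by (intro mult_left_mono) auto
      also have "\<dots> = (\<integral>\<^sup>+x. ennreal Y * indicator E x \<partial>N)" by (simp add: nn_integral_cmult)
      finally show False by simp
    qed
    then obtain x where x: "x \<in> E" "J x \<le> ennreal Y" by auto
    then have "x \<in> space N" using sets.sets_into_space[OF E] by auto
    have "c * \<sigma> powr (-a) * Y powr (1/p) = c * c powr (1/p) * m powr (1/p)"
      using c m p \<sigma> by (simp add: Y_def powr_mult powr_powr powr_minus field_simps)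
    then show "\<exists>x\<in>E. (\<integral>\<^sup>+y. ennreal (k x y * h y) * indicator {y. k x y > \<sigma>} y \<partial>M)
        \<le> ennreal (c * c powr (1/p) * m powr (1/p))"
      using pw[OF \<open>x \<in> space N\<close> \<sigma> h nonneg \<open>0 \<le> Y\<close> x(2)[unfolded J_def]] x(1) by (metis (no_types, lifting))
  qed
qed


section \<open>Splitting the function and summing over levels\<close>

text \<open>The order of quantifiers is the point: \<open>m\<close> depends on f and
  \<open>v1\<close> only, so one and the same mass enters the estimates for all \<open>v2\<close>,
  \<open>w\<close> and \<open>E\<close>. This is what allows two levels to be compared. For v2 = v1
  the statement contains the weak-type bound.\<close>

lemma key_estimate:
  obtains C where "C > 0"
    "\<And>f v1. \<lbrakk>f \<in> borel_measurable M; \<And>y. 0 \<le> f y; (\<integral>\<^sup>+y. ennreal (f y powr p) \<partial>M) \<le> 1;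
      0 \<le> v1; exp (-v1) \<le> measure M (space M)\<rbrakk> \<Longrightarrow>
      \<exists>m. 0 \<le> m \<and> m \<le> 1 \<and> (\<forall>v2 w E. v1 \<le> v2 \<longrightarrow> 0 \<le> w \<longrightarrow> E \<in> sets N \<longrightarrow>
        ennreal (exp (-(\<beta>0 / \<beta> * v2))) \<le> emeasure N E \<longrightarrow>
        (\<forall>x\<in>E. ennreal w \<le> (\<integral>\<^sup>+y. ennreal (k x y * f y) \<partial>M)) \<longrightarrow>
        w \<le> (A * v1 + C) powr (1/\<beta>) * (1 - m) powr (1/p) + C * (v2 - v1 + 1) powr (1/\<beta>) * m powr (1/p))"
proof -
  obtain C1 where C1: "C1 > 0"
    and band: "\<And>x \<sigma>1 \<sigma>2. x \<in> space N \<Longrightarrow> 1 \<le> \<sigma>1 \<Longrightarrow> \<sigma>1 \<le> \<sigma>2 \<Longrightarrow>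
      (\<integral>\<^sup>+y. ennreal (k x y powr \<beta>) * indicator {y. \<sigma>1 < k x y \<and> k x y \<le> \<sigma>2} y \<partial>M)
      \<le> ennreal (A * \<beta> * ln (\<sigma>2 / \<sigma>1) + C1)"
    and low: "\<And>x \<sigma>. x \<in> space N \<Longrightarrow> 1 \<le> \<sigma> \<Longrightarrow>
      (\<integral>\<^sup>+y. ennreal (k x y powr \<beta>) * indicator {y. k x y \<le> \<sigma>} y \<partial>M) \<le> ennreal (A * \<beta> * ln \<sigma> + C1)"
    by (rule band_moment) blast
  obtain c1 where c1: "c1 > 0" and first: "\<And>x \<sigma>. x \<in> space N \<Longrightarrow> 1 \<le> \<sigma> \<Longrightarrow>
    (\<integral>\<^sup>+y. ennreal (k x y powr 1) * indicator {y. k x y > \<sigma>} y \<partial>M) \<le> ennreal (c1 * \<sigma> powr (1 - \<beta>))"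
    by (rule tail_moment1[OF zero_less_one beta]) blast
  obtain c2 where c2: "0 < c2"
    and good: "\<And>\<sigma> h m E. \<lbrakk>1 \<le> \<sigma>; h \<in> borel_measurable M; \<And>y. 0 \<le> h y; 0 \<le> m;
      (\<integral>\<^sup>+y. ennreal (h y powr p) \<partial>M) \<le> ennreal m;
      E \<in> sets N; ennreal (\<sigma> powr (-\<beta>0)) \<le> emeasure N E\<rbrakk> \<Longrightarrow>
      \<exists>x\<in>E. (\<integral>\<^sup>+y. ennreal (k x y * h y) * indicator {y. k x y > \<sigma>} y \<partial>M) \<le> ennreal (c2 * m powr (1/p))"
    by (rule tail_good_point) blast
  \<comment> \<open>One constant is used in two places: under the first root it must dominate C1,
    and as a coefficient it must dominate the bounded contributions c1, 1, c2 together with (A +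
    C1)^(1/\<beta>), which stems from A (v2-v1) + C1 \<le> (A + C1)(v2 - v1 + 1).\<close>
  define C where "C = C1 + (c1 + 1 + c2 + (A + C1) powr (1/\<beta>))"
  have "C > 0" using C1 c1 c2 by (auto simp: C_def intro!: add_pos_nonneg)
  then show thesis
  proof (rule that)
    fix f :: "'a \<Rightarrow> real" and v1 :: real
    assume f[measurable]: "f \<in> borel_measurable M" and nonneg: "\<And>y. 0 \<le> f y"
      and norm: "(\<integral>\<^sup>+y. ennreal (f y powr p) \<partial>M) \<le> 1"
      and v1: "0 \<le> v1" "exp (-v1) \<le> measure M (space M)"
    \<comment> \<open>The cuts of f and k are matched: \<tau> = \<sigma>1^(-\<beta>) is the order of
      the measure of {k(x,.) > \<sigma>1}.\<close>
    define \<tau> where "\<tau> = exp (-v1)"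
    define \<sigma>1 where "\<sigma>1 = exp (v1 / \<beta>)"
    have \<tau>: "0 < \<tau>" "\<tau> \<le> measure M (space M)" using v1 by (auto simp: \<tau>_def)
    have \<sigma>1: "1 \<le> \<sigma>1" "ln \<sigma>1 = v1 / \<beta>" "\<tau> = \<sigma>1 powr (-\<beta>)"
      using v1 beta by (auto simp: \<sigma>1_def \<tau>_def powr_def)
    obtain \<theta> z where [measurable]: "\<theta> \<in> borel_measurable M" and \<theta>: "\<And>y. 0 \<le> \<theta> y" "\<And>y. \<theta> y \<le> 1" and "0 \<le> z"
      and \<theta>z: "\<And>y. 0 < \<theta> y \<Longrightarrow> z \<le> f y" "\<And>y. \<theta> y < 1 \<Longrightarrow> f y \<le> z"
      and \<theta>\<tau>: "(\<integral>\<^sup>+y. ennreal (\<theta> y) \<partial>M) = ennreal \<tau>"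
      by (rule split_at_level[OF M.finite_measure_axioms f nonneg \<tau>]) blast
    define f1 f2 where "f1 y = \<theta> y * f y" and "f2 y = (1 - \<theta> y) * f y" for y
    have [measurable]: "f1 \<in> borel_measurable M" "f2 \<in> borel_measurable M"
      unfolding f1_def f2_def by measurable
    have f12: "0 \<le> f1 y" "0 \<le> f2 y" "f y = f1 y + f2 y" for y
      using \<theta> nonneg by (auto simp: f1_def f2_def algebra_simps intro: mult_left_le_one_le)
    have f2z: "f2 y \<le> z" for y
    proof (cases "\<theta> y < 1")
      case True
      have "(1 - \<theta> y) * f y \<le> 1 * z" using \<theta> nonneg \<theta>z(2)[OF True] by (intro mult_mono) auto
      then show ?thesis by (simp add: f2_def)
    next
      case False
      then show ?thesis using \<theta>(2)[of y] \<open>0 \<le> z\<close> by (simp add: f2_def)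
    qed
    \<comment> \<open>The masses carry the weights \<theta> and 1 - \<theta>, not their p-th powers,
      so that they add up to the full p-th moment of f. Since the weights are at most 1 and p > 1,
      they still dominate the p-th moments of \<open>f1\<close> and \<open>f2\<close>.\<close>
    define m where "m = enn2real (\<integral>\<^sup>+y. ennreal (\<theta> y * f y powr p) \<partial>M)"
    define m2 where "m2 = enn2real (\<integral>\<^sup>+y. ennreal ((1 - \<theta> y) * f y powr p) \<partial>M)"
    have m_sum: "(\<integral>\<^sup>+y. ennreal (\<theta> y * f y powr p) \<partial>M) + (\<integral>\<^sup>+y. ennreal ((1 - \<theta> y) * f y powr p) \<partial>M) \<le> 1"
    proof -
      have "(\<integral>\<^sup>+y. ennreal (\<theta> y * f y powr p) \<partial>M) + (\<integral>\<^sup>+y. ennreal ((1 - \<theta> y) * f y powr p) \<partial>M)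
        = (\<integral>\<^sup>+y. ennreal (\<theta> y * f y powr p) + ennreal ((1 - \<theta> y) * f y powr p) \<partial>M)"
        by (rule nn_integral_add[symmetric]) measurable
      also have "\<dots> = (\<integral>\<^sup>+y. ennreal (f y powr p) \<partial>M)"
        using \<theta> by (intro nn_integral_cong, subst ennreal_plus[symmetric]) (auto simp: algebra_simps intro: mult_left_le_one_le)
      finally show ?thesis using norm by simp
    qed
    then have fin: "(\<integral>\<^sup>+y. ennreal (\<theta> y * f y powr p) \<partial>M) < \<infinity>" "(\<integral>\<^sup>+y. ennreal ((1 - \<theta> y) * f y powr p) \<partial>M) < \<infinity>"
      by (auto simp: top_unique less_top[symmetric])
    then have m_eq: "(\<integral>\<^sup>+y. ennreal (\<theta> y * f y powr p) \<partial>M) = ennreal m"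
        "(\<integral>\<^sup>+y. ennreal ((1 - \<theta> y) * f y powr p) \<partial>M) = ennreal m2"
      by (simp_all add: m_def m2_def)
    have m0: "0 \<le> m" "0 \<le> m2" by (auto simp: m_def m2_def)
    have "ennreal (m + m2) \<le> ennreal 1" using m_sum m0 unfolding m_eq by (simp add: ennreal_plus)
    then have "m + m2 \<le> 1" by (subst (asm) ennreal_le_iff) auto
    then have m1: "m \<le> 1" "m2 \<le> 1 - m" using m0 by auto
    have f1m: "(\<integral>\<^sup>+y. ennreal (f1 y powr p) \<partial>M) \<le> ennreal m"
      unfolding m_eq(1)[symmetric] f1_def
    proof (intro nn_integral_mono ennreal_leI)
      fix y
      have "\<theta> y powr p \<le> \<theta> y powr 1" using \<theta>[of y] p by (intro powr_mono') auto
      then have "\<theta> y powr p * f y powr p \<le> \<theta> y * f y powr p" using \<theta> by (intro mult_right_mono) auto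
      then show "(\<theta> y * f y) powr p \<le> \<theta> y * f y powr p" using \<theta> nonneg by (simp add: powr_mult)
    qed
    have f2m: "(\<integral>\<^sup>+y. ennreal (f2 y powr p) \<partial>M) \<le> ennreal (1 - m)"
    proof -
      have "(\<integral>\<^sup>+y. ennreal (f2 y powr p) \<partial>M) \<le> ennreal m2"
        unfolding m_eq(2)[symmetric] f2_def
      proof (intro nn_integral_mono ennreal_leI)
        fix y
        have "(1 - \<theta> y) powr p \<le> (1 - \<theta> y) powr 1" using \<theta>[of y] p by (intro powr_mono') auto
        then have "(1 - \<theta> y) powr p * f y powr p \<le> (1 - \<theta> y) * f y powr p" using \<theta> by (intro mult_right_mono) auto
        then show "((1 - \<theta> y) * f y) powr p \<le> (1 - \<theta> y) * f y powr p" using \<theta> nonneg by (simp add: powr_mult)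
      qed
      also have "\<dots> \<le> ennreal (1 - m)" using m1 by (intro ennreal_leI)
      finally show ?thesis .
    qed
    \<comment> \<open>Chebyshev on the support of \<theta>: z^p \<tau> \<le> m. The resulting power
      \<sigma>1^(\<beta>-1) is exactly inverse to the first moment of k above \<sigma>1.\<close>
    have zm: "z \<le> m powr (1/p) * \<sigma>1 powr (\<beta> - 1)"
    proof -
      have "ennreal (z powr p * \<tau>) = (\<integral>\<^sup>+y. ennreal (z powr p) * ennreal (\<theta> y) \<partial>M)"
        using \<tau> by (simp add: nn_integral_cmult \<theta>\<tau> ennreal_mult)
      also have "\<dots> \<le> (\<integral>\<^sup>+y. ennreal (\<theta> y * f y powr p) \<partial>M)"
      proof (intro nn_integral_mono)
        fix y
        show "ennreal (z powr p) * ennreal (\<theta> y) \<le> ennreal (\<theta> y * f y powr p)"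
        proof (cases "0 < \<theta> y")
          case True
          then have "z powr p * \<theta> y \<le> f y powr p * \<theta> y"
            using \<theta>z(1)[OF True] \<open>0 \<le> z\<close> p by (intro mult_right_mono powr_mono2) auto
          then show ?thesis using \<theta> by (simp add: mult.commute flip: ennreal_mult)
        next
          case False
          then show ?thesis using \<theta>(1)[of y] by simp
        qed
      qed
      finally have "z powr p * \<tau> \<le> m" unfolding m_eq using m0 by (simp add: ennreal_le_iff)
      then have "z powr p \<le> m * \<sigma>1 powr \<beta>" using \<sigma>1 by (simp add: powr_minus field_simps)
      then have "(z powr p) powr (1/p) \<le> (m * \<sigma>1 powr \<beta>) powr (1/p)" using p by (intro powr_mono2) auto
      then show ?thesis using p m0 \<open>0 \<le> z\<close> by (simp add: powr_powr powr_mult)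
    qed
    \<comment> \<open>Hoelder with \<theta> = \<theta>^(1/\<beta>) \<theta>^(1/p): the first factor
      brings in \<tau>^(1/\<beta>) = 1/\<sigma>1, which compensates the bound k \<le> \<sigma>1
      below the cut.\<close>
    have f1int: "(\<integral>\<^sup>+y. ennreal (f1 y) \<partial>M) \<le> ennreal (m powr (1/p) / \<sigma>1)"
    proof -
      have "(\<integral>\<^sup>+y. ennreal (f1 y) \<partial>M) = (\<integral>\<^sup>+y. ennreal (\<theta> y powr (1/\<beta>) * (\<theta> y powr (1/p) * f y)) \<partial>M)"
        using \<theta> p by (intro nn_integral_cong) (auto simp: f1_def mult.assoc[symmetric] simp flip: powr_add)
      also have "\<dots> \<le> ennreal (\<tau> powr (1/\<beta>) * m powr (1/p))"
      proof (rule nn_integral_Holder)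
        show "(\<integral>\<^sup>+y. ennreal ((\<theta> y powr (1/\<beta>)) powr \<beta>) \<partial>M) \<le> ennreal \<tau>"
          using \<theta> beta by (simp add: powr_powr \<theta>\<tau>)
        show "(\<integral>\<^sup>+y. ennreal ((\<theta> y powr (1/p) * f y) powr p) \<partial>M) \<le> ennreal m"
          using \<theta> nonneg p by (simp add: powr_powr powr_mult m_eq)
      qed (use p beta \<tau> m0 \<theta> nonneg in auto)
      also have "\<tau> powr (1/\<beta>) * m powr (1/p) = m powr (1/p) / \<sigma>1"
      proof -
        have "\<tau> powr (1/\<beta>) = \<sigma>1 powr (-1)"
          unfolding \<sigma>1(3) powr_powr using beta by simp
        then show ?thesis using \<sigma>1(1) by (simp add: powr_minus_divide)
      qed
      finally show ?thesis .
    qed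
    show "\<exists>m. 0 \<le> m \<and> m \<le> 1 \<and> (\<forall>v2 w E. v1 \<le> v2 \<longrightarrow> 0 \<le> w \<longrightarrow> E \<in> sets N \<longrightarrow>
        ennreal (exp (-(\<beta>0 / \<beta> * v2))) \<le> emeasure N E \<longrightarrow>
        (\<forall>x\<in>E. ennreal w \<le> (\<integral>\<^sup>+y. ennreal (k x y * f y) \<partial>M)) \<longrightarrow>
        w \<le> (A * v1 + C) powr (1/\<beta>) * (1 - m) powr (1/p) + C * (v2 - v1 + 1) powr (1/\<beta>) * m powr (1/p))"
    proof (intro exI[of _ m] conjI allI impI)
      fix v2 w :: real and E
      assume v2: "v1 \<le> v2" and "0 \<le> w" and E: "E \<in> sets N"
        and big: "ennreal (exp (-(\<beta>0 / \<beta> * v2))) \<le> emeasure N E"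
        and wle: "\<forall>x\<in>E. ennreal w \<le> (\<integral>\<^sup>+y. ennreal (k x y * f y) \<partial>M)"
      define \<sigma>2 where "\<sigma>2 = exp (v2 / \<beta>)"
      have \<sigma>2: "1 \<le> \<sigma>2" "\<sigma>1 \<le> \<sigma>2" "ln (\<sigma>2 / \<sigma>1) = (v2 - v1) / \<beta>"
        using v1 v2 beta by (auto simp: \<sigma>1_def \<sigma>2_def divide_right_mono diff_divide_distrib simp flip: exp_diff)
      have "ennreal (\<sigma>2 powr (-\<beta>0)) \<le> emeasure N E" using big by (simp add: \<sigma>2_def powr_def)
      from good[OF \<sigma>2(1) _ f12(1) m0(1) f1m E this]
      obtain x where x: "x \<in> E"
        and I5: "(\<integral>\<^sup>+y. ennreal (k x y * f1 y) * indicator {y. k x y > \<sigma>2} y \<partial>M) \<le> ennreal (c2 * m powr (1/p))"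
        by auto
      have xN[measurable]: "x \<in> space N" using x sets.sets_into_space[OF E] by auto
      \<comment> \<open>Only I1 carries the factor $(1-m)^{1/p}$; the other four pieces are small with $m$:
        I2 because f2 is at most z, I3 because the support of f1 has small measure, I4 by Hoelder on the
        band between the two levels, I5 by the choice of x.\<close>
      have I1: "(\<integral>\<^sup>+y. ennreal (k x y * indicator {y. k x y \<le> \<sigma>1} y * f2 y) \<partial>M)
          \<le> ennreal ((A * v1 + C1) powr (1/\<beta>) * (1 - m) powr (1/p))"
      proof (rule nn_integral_Holder)
        have "(\<integral>\<^sup>+y. ennreal ((k x y * indicator {y. k x y \<le> \<sigma>1} y) powr \<beta>) \<partial>M) =
            (\<integral>\<^sup>+y. ennreal (k x y powr \<beta>) * indicator {y. k x y \<le> \<sigma>1} y \<partial>M)"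
          by (intro nn_integral_cong) (auto simp: indicator_def)
        then show "(\<integral>\<^sup>+y. ennreal ((k x y * indicator {y. k x y \<le> \<sigma>1} y) powr \<beta>) \<partial>M) \<le> ennreal (A * v1 + C1)"
          using low[OF xN \<sigma>1(1)] \<sigma>1(2) beta by simp
      qed (use p beta f2m f12 m1 A_pos v1 C1 k_nonneg in auto)
      have I2: "(\<integral>\<^sup>+y. ennreal (k x y * f2 y) * indicator {y. k x y > \<sigma>1} y \<partial>M) \<le> ennreal (c1 * m powr (1/p))"
      proof -
        have "(\<integral>\<^sup>+y. ennreal (k x y * f2 y) * indicator {y. k x y > \<sigma>1} y \<partial>M) \<le>
           (\<integral>\<^sup>+y. ennreal z * (ennreal (k x y powr 1) * indicator {y. k x y > \<sigma>1} y) \<partial>M)"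
          using f2z \<open>0 \<le> z\<close> k_nonneg
          by (intro nn_integral_mono)
             (auto simp: indicator_def mult.commute intro!: mult_right_mono mult_left_mono ennreal_leI simp flip: ennreal_mult)
        also have "\<dots> = ennreal z * (\<integral>\<^sup>+y. ennreal (k x y powr 1) * indicator {y. k x y > \<sigma>1} y \<partial>M)"
          by (rule nn_integral_cmult) measurable
        also have "\<dots> \<le> ennreal (m powr (1/p) * \<sigma>1 powr (\<beta> - 1)) * ennreal (c1 * \<sigma>1 powr (1 - \<beta>))"
          using first[OF xN \<sigma>1(1)] zm by (intro mult_mono ennreal_leI) auto
        also have "\<dots> = ennreal (m powr (1/p) * c1 * (\<sigma>1 powr (\<beta> - 1) * \<sigma>1 powr (1 - \<beta>)))"
          using c1 by (simp add: mult_ac flip: ennreal_mult)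
        also have "\<sigma>1 powr (\<beta> - 1) * \<sigma>1 powr (1 - \<beta>) = 1" using \<sigma>1 by (simp flip: powr_add)
        finally show ?thesis by (simp add: mult.commute)
      qed
      have I3: "(\<integral>\<^sup>+y. ennreal (k x y * f1 y) * indicator {y. k x y \<le> \<sigma>1} y \<partial>M) \<le> ennreal (m powr (1/p))"
      proof -
        have "(\<integral>\<^sup>+y. ennreal (k x y * f1 y) * indicator {y. k x y \<le> \<sigma>1} y \<partial>M) \<le> (\<integral>\<^sup>+y. ennreal \<sigma>1 * ennreal (f1 y) \<partial>M)"
          using f12 \<sigma>1 k_nonneg
          by (intro nn_integral_mono) (auto simp: indicator_def intro!: mult_right_mono ennreal_leI simp flip: ennreal_mult)
        also have "\<dots> = ennreal \<sigma>1 * (\<integral>\<^sup>+y. ennreal (f1 y) \<partial>M)" by (rule nn_integral_cmult) measurable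
        also have "\<dots> \<le> ennreal \<sigma>1 * ennreal (m powr (1/p) / \<sigma>1)" using f1int by (intro mult_left_mono) auto
        also have "\<dots> = ennreal (m powr (1/p))" using \<sigma>1 by (simp flip: ennreal_mult)
        finally show ?thesis .
      qed
      have I4: "(\<integral>\<^sup>+y. ennreal (k x y * indicator {y. \<sigma>1 < k x y \<and> k x y \<le> \<sigma>2} y * f1 y) \<partial>M)
          \<le> ennreal ((A * (v2 - v1) + C1) powr (1/\<beta>) * m powr (1/p))"
      proof (rule nn_integral_Holder)
        have "(\<integral>\<^sup>+y. ennreal ((k x y * indicator {y. \<sigma>1 < k x y \<and> k x y \<le> \<sigma>2} y) powr \<beta>) \<partial>M) =
            (\<integral>\<^sup>+y. ennreal (k x y powr \<beta>) * indicator {y. \<sigma>1 < k x y \<and> k x y \<le> \<sigma>2} y \<partial>M)"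
          by (intro nn_integral_cong) (auto simp: indicator_def)
        then show "(\<integral>\<^sup>+y. ennreal ((k x y * indicator {y. \<sigma>1 < k x y \<and> k x y \<le> \<sigma>2} y) powr \<beta>) \<partial>M)
            \<le> ennreal (A * (v2 - v1) + C1)"
          using band[OF xN \<sigma>1(1) \<sigma>2(2)] \<sigma>2(3) beta by simp
      qed (use p beta f1m f12 m0 A_pos v2 C1 k_nonneg in auto)
      let ?D = "v2 - v1 + 1"
      have "ennreal w \<le> (\<integral>\<^sup>+y. ennreal (k x y * f y) \<partial>M)" using wle x by auto
      also have "\<dots> = (\<integral>\<^sup>+y. ennreal (k x y * indicator {y. k x y \<le> \<sigma>1} y * f2 y)
            + (ennreal (k x y * f2 y) * indicator {y. k x y > \<sigma>1} y
            + (ennreal (k x y * f1 y) * indicator {y. k x y \<le> \<sigma>1} y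
            + (ennreal (k x y * indicator {y. \<sigma>1 < k x y \<and> k x y \<le> \<sigma>2} y * f1 y)
            + ennreal (k x y * f1 y) * indicator {y. k x y > \<sigma>2} y))) \<partial>M)"
        using f12 k_nonneg \<sigma>2
        by (intro nn_integral_cong) (auto simp: indicator_def algebra_simps simp flip: ennreal_plus)
      also have "\<dots> = (\<integral>\<^sup>+y. ennreal (k x y * indicator {y. k x y \<le> \<sigma>1} y * f2 y) \<partial>M)
            + ((\<integral>\<^sup>+y. ennreal (k x y * f2 y) * indicator {y. k x y > \<sigma>1} y \<partial>M)
            + ((\<integral>\<^sup>+y. ennreal (k x y * f1 y) * indicator {y. k x y \<le> \<sigma>1} y \<partial>M)
            + ((\<integral>\<^sup>+y. ennreal (k x y * indicator {y. \<sigma>1 < k x y \<and> k x y \<le> \<sigma>2} y * f1 y) \<partial>M)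
            + (\<integral>\<^sup>+y. ennreal (k x y * f1 y) * indicator {y. k x y > \<sigma>2} y \<partial>M))))"
        by (simp add: nn_integral_add)
      also have "\<dots> \<le> ennreal ((A * v1 + C1) powr (1/\<beta>) * (1 - m) powr (1/p))
            + (ennreal (c1 * m powr (1/p)) + (ennreal (m powr (1/p))
            + (ennreal ((A * (v2 - v1) + C1) powr (1/\<beta>) * m powr (1/p)) + ennreal (c2 * m powr (1/p)))))"
        by (intro add_mono I1 I2 I3 I4 I5)
      also have "\<dots> = ennreal ((A * v1 + C1) powr (1/\<beta>) * (1 - m) powr (1/p)
          + (c1 + 1 + (A * (v2 - v1) + C1) powr (1/\<beta>) + c2) * m powr (1/p))"
        using c1 c2 by (simp add: algebra_simps flip: ennreal_plus)
      finally have "w \<le> (A * v1 + C1) powr (1/\<beta>) * (1 - m) powr (1/p)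
          + (c1 + 1 + (A * (v2 - v1) + C1) powr (1/\<beta>) + c2) * m powr (1/p)"
        using c1 c2 by (subst (asm) ennreal_le_iff) auto
      also have "\<dots> \<le> (A * v1 + C) powr (1/\<beta>) * (1 - m) powr (1/p) + (C * ?D powr (1/\<beta>)) * m powr (1/p)"
      proof (intro add_mono mult_right_mono)
        show "(A * v1 + C1) powr (1/\<beta>) \<le> (A * v1 + C) powr (1/\<beta>)"
          using A_pos v1 C1 c1 c2 beta by (intro powr_mono2) (auto simp: C_def)
        have D1: "1 \<le> ?D powr (1/\<beta>)" using v2 beta by (intro ge_one_powr_ge_zero) auto
        have "(A * (v2 - v1) + C1) powr (1/\<beta>) \<le> ((A + C1) * ?D) powr (1/\<beta>)"
        proof (intro powr_mono2)
          have "0 \<le> A + C1 * (v2 - v1)" using v2 A_pos C1 by auto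
          then show "A * (v2 - v1) + C1 \<le> (A + C1) * ?D" by (simp add: algebra_simps)
        qed (use v2 A_pos C1 beta in auto)
        also have "\<dots> = (A + C1) powr (1/\<beta>) * ?D powr (1/\<beta>)" using v2 A_pos C1 by (simp add: powr_mult)
        finally have "c1 + 1 + (A * (v2 - v1) + C1) powr (1/\<beta>) + c2 \<le> (c1 + 1 + c2) * 1 + (A + C1) powr (1/\<beta>) * ?D powr (1/\<beta>)"
          by simp
        also have "\<dots> \<le> (c1 + 1 + c2) * ?D powr (1/\<beta>) + (A + C1) powr (1/\<beta>) * ?D powr (1/\<beta>)"
          using D1 c1 c2 by (intro add_right_mono mult_left_mono) auto
        also have "\<dots> \<le> C * ?D powr (1/\<beta>)"
          using C1 by (simp add: C_def algebra_simps)
        finally show "c1 + 1 + (A * (v2 - v1) + C1) powr (1/\<beta>) + c2 \<le> C * ?D powr (1/\<beta>)" .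
      qed auto
      finally show "w \<le> (A * v1 + C) powr (1/\<beta>) * (1 - m) powr (1/p) + C * ?D powr (1/\<beta>) * m powr (1/p)" .
    qed (use m0 m1 in auto)
  qed
qed


text \<open>The terms satisfy both premises of \<open>sum_bound_of_sparse_levels\<close>.
  \<open>key_estimate\<close> with v2 = v1 gives the uniform bound; \<open>key_estimate\<close>
  split at v1 = n1 + l and used for the level sets of n1 and n2 supplies the premises of
  \<open>gap_estimate\<close>. Allowing any U below the integral of k f, rather than that integral
  itself, admits the operator also at points where its integral does not converge.\<close>

lemma exp_sum_bound:
  obtains S where "S \<ge> 0"
    "\<And>f U n. \<lbrakk>f \<in> borel_measurable M; \<And>y. 0 \<le> f y; (\<integral>\<^sup>+y. ennreal (f y powr p) \<partial>M) \<le> 1;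
      U \<in> borel_measurable N; \<And>x. 0 \<le> U x; \<And>x. x \<in> space N \<Longrightarrow> ennreal (U x) \<le> (\<integral>\<^sup>+y. ennreal (k x y * f y) \<partial>M)\<rbrakk> \<Longrightarrow>
      (\<Sum>i<n. exp (\<beta>0 / \<beta> * real i) * measure N {x\<in>space N. U x powr \<beta> / A > real i}) \<le> S"
proof (cases "measure M (space M) = 0")
  case True
  show thesis
  proof (rule that[of 0])
    fix f :: "'a \<Rightarrow> real" and U n
    assume [measurable]: "f \<in> borel_measurable M" and U: "\<And>x. (0::real) \<le> U x"
      and le: "\<And>x. x \<in> space N \<Longrightarrow> ennreal (U x) \<le> (\<integral>\<^sup>+y. ennreal (k x y * f y) \<partial>M)"
    have "emeasure M (space M) = 0" using True by (simp add: M.emeasure_eq_measure)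
    then have AE: "AE y in M. P y" for P by (intro AE_I[where N = "space M"]) auto
    have "U x = 0" if [measurable]: "x \<in> space N" for x
    proof -
      have "(\<integral>\<^sup>+y. ennreal (k x y * f y) \<partial>M) = 0"
        by (subst nn_integral_0_iff_AE) (auto intro: AE)
      then show ?thesis using le[OF that] U[of x] by (simp add: ennreal_eq_0_iff)
    qed
    then have empty: "{x\<in>space N. U x powr \<beta> / A > real i} = {}" for i by auto
    show "(\<Sum>i<n. exp (\<beta>0 / \<beta> * real i) * measure N {x\<in>space N. U x powr \<beta> / A > real i}) \<le> 0"
      unfolding empty by simp
  qed simp
next
  case False
  define \<mu> where "\<mu> = measure M (space M)"
  have "\<mu> > 0" using False by (simp add: \<mu>_def less_le)
  define b where "b = \<beta>0 / \<beta>"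
  have "b > 0" using beta beta0 by (simp add: b_def)
  \<comment> \<open>From \<open>v0\<close> on, exp(-v) does not exceed the total mass of M, so that
    f can be split at that measure. This is why a space of measure zero is treated apart.\<close>
  define v0 where "v0 = max 0 (- ln \<mu>)"
  have v0: "v0 \<ge> 0" "exp (-v) \<le> \<mu>" if "v0 \<le> v" for v
  proof -
    have "- v \<le> ln \<mu>" using that by (simp add: v0_def)
    then show "exp (-v) \<le> \<mu>" using \<open>\<mu> > 0\<close> by (simp add: ln_ge_iff)
  qed (simp add: v0_def)
  define \<nu> where "\<nu> = measure N (space N)"
  have "\<nu> \<ge> 0" by (simp add: \<nu>_def)
  show thesis
  proof (rule key_estimate)
    fix C :: real assume C: "C > 0"
    assume key: "\<And>f v1. \<lbrakk>f \<in> borel_measurable M; \<And>y. 0 \<le> f y; (\<integral>\<^sup>+y. ennreal (f y powr p) \<partial>M) \<le> 1;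
      0 \<le> v1; exp (-v1) \<le> measure M (space M)\<rbrakk> \<Longrightarrow>
      \<exists>m. 0 \<le> m \<and> m \<le> 1 \<and> (\<forall>v2 w E. v1 \<le> v2 \<longrightarrow> 0 \<le> w \<longrightarrow> E \<in> sets N \<longrightarrow>
        ennreal (exp (-(\<beta>0 / \<beta> * v2))) \<le> emeasure N E \<longrightarrow>
        (\<forall>x\<in>E. ennreal w \<le> (\<integral>\<^sup>+y. ennreal (k x y * f y) \<partial>M)) \<longrightarrow>
        w \<le> (A * v1 + C) powr (1/\<beta>) * (1 - m) powr (1/p) + C * (v2 - v1 + 1) powr (1/\<beta>) * m powr (1/p))"
    \<comment> \<open>Dividing the estimate by A^(1/\<beta>) passes from U to the normalised level W
      = U^\<beta> / A.\<close>
    define C' where "C' = C / A powr (1/\<beta>)"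
    have C': "C' > 0" "C / A \<ge> 0" using C A_pos by (auto simp: C'_def)
    obtain K0 where K0: "K0 > 0"
      and gap: "\<And>l w1 w2 m. \<lbrakk>1 \<le> l; 0 \<le> m; m \<le> 1; K0 * l \<le> w1; w1 \<le> w2;
      w1 powr (1/\<beta>) \<le> (w1 + l + C / A) powr (1/\<beta>) * (1 - m) powr (1/p) + C' * m powr (1/p);
      w2 powr (1/\<beta>) \<le> (w1 + l + C / A) powr (1/\<beta>) * (1 - m) powr (1/p) + C' * (w2 - w1 + 1) powr (1/\<beta>) * m powr (1/p)\<rbrakk>
      \<Longrightarrow> w2 - w1 \<le> K0 * l"
      using gap_estimate[OF beta p(1) p(3) C'(2) C'(1)] by blast
    define K where "K = max K0 v0"
    have K: "K > 0" "K0 \<le> K" "v0 \<le> K" using K0 by (auto simp: K_def)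
    \<comment> \<open>\<open>c\<close> is chosen so that A (i - c) + C + C^\<beta> = A (i - 1),
      which falls short of A i by a fixed amount. In \<open>c0\<close> the further summands take
      care of the finitely many i below v0 + c, where the total mass of N is the bound.\<close>
    define c where "c = (C + C powr \<beta>) / A + 1"
    define c0 where "c0 = c + v0 + \<nu> / b"
    have "c \<ge> 0" using C A_pos by (simp add: c_def)
    have "c0 \<ge> 0" using \<open>c \<ge> 0\<close> v0(1)[of v0] \<open>\<nu> \<ge> 0\<close> \<open>b > 0\<close> by (simp add: c0_def)
    obtain S where S: "S \<ge> 0"
      and sum: "\<And>a n. \<lbrakk>\<And>n. 0 \<le> a n; \<And>n. a n \<le> exp (b * c0);
       \<And>l n1 n2. \<lbrakk>1 \<le> l; n1 \<le> n2; K * l \<le> real n1; exp (-(b * l)) \<le> a n1; exp (-(b * l)) \<le> a n2\<rbrakk>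
          \<Longrightarrow> real n2 - real n1 \<le> K * l\<rbrakk> \<Longrightarrow> (\<Sum>i<n. a i) \<le> S"
      using sum_bound_of_sparse_levels[OF K(1) \<open>b > 0\<close> \<open>c0 \<ge> 0\<close>] by blast
    show thesis
    proof (rule that[OF S])
      fix f :: "'a \<Rightarrow> real" and U and n :: nat
      assume f[measurable]: "f \<in> borel_measurable M" and f0: "\<And>y. 0 \<le> f y"
        and norm: "(\<integral>\<^sup>+y. ennreal (f y powr p) \<partial>M) \<le> 1"
        and [measurable]: "U \<in> borel_measurable N" and U0: "\<And>x. (0::real) \<le> U x"
        and le: "\<And>x. x \<in> space N \<Longrightarrow> ennreal (U x) \<le> (\<integral>\<^sup>+y. ennreal (k x y * f y) \<partial>M)"
      define E where "E i = {x\<in>space N. U x powr \<beta> / A > real i}" for i :: nat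
      have E[measurable]: "E i \<in> sets N" for i unfolding E_def by measurable
      have UE: "\<forall>x\<in>E i. ennreal ((A * real i) powr (1/\<beta>)) \<le> (\<integral>\<^sup>+y. ennreal (k x y * f y) \<partial>M)" for i
      proof
        fix x assume x: "x \<in> E i"
        then have "A * real i \<le> U x powr \<beta>" using A_pos by (simp add: E_def field_simps)
        then have "(A * real i) powr (1/\<beta>) \<le> (U x powr \<beta>) powr (1/\<beta>)"
          using A_pos beta by (intro powr_mono2) auto
        also have "\<dots> = U x" using beta U0 by (simp add: powr_powr)
        finally show "ennreal ((A * real i) powr (1/\<beta>)) \<le> (\<integral>\<^sup>+y. ennreal (k x y * f y) \<partial>M)"
          using le[of x] x by (auto simp: E_def intro: order_trans ennreal_leI)
      qed
      have Epow: "(A * real i) powr (1/\<beta>) = A powr (1/\<beta>) * real i powr (1/\<beta>)" for i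
        using A_pos by (simp add: powr_mult)
      have Apow: "A powr (1/\<beta>) > 0" using A_pos by simp
      define a where "a i = exp (b * real i) * measure N (E i)" for i
      \<comment> \<open>A lower bound on a_i is a lower bound on the measure of \<open>E i\<close>,
        in the form that \<open>key_estimate\<close> asks for with v2 = i + l.\<close>
      have a_le: "ennreal (exp (-(b * (real i + l)))) \<le> emeasure N (E i)" if "exp (-(b * l)) \<le> a i" for i l
      proof -
        have "exp (-(b * real i)) * exp (-(b * l)) \<le> exp (-(b * real i)) * a i"
          using that by (intro mult_left_mono) auto
        also have "\<dots> = (exp (-(b * real i)) * exp (b * real i)) * measure N (E i)" by (simp add: a_def)
        also have "\<dots> = measure N (E i)" by (simp flip: exp_add)
        finally show ?thesis
          by (simp add: N.emeasure_eq_measure algebra_simps flip: exp_add)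
      qed
      have "(\<Sum>i<n. a i) \<le> S"
      proof (rule sum)
        show "0 \<le> a i" for i by (simp add: a_def)
        fix i
        show "a i \<le> exp (b * c0)"
        proof (cases "v0 + c \<le> real i")
          case False
          have "a i \<le> exp (b * (v0 + c)) * \<nu>"
            unfolding a_def \<nu>_def using False \<open>b > 0\<close>
            by (intro mult_mono N.finite_measure_mono) (auto simp: E_def)
          also have "\<dots> \<le> exp (b * (v0 + c)) * exp \<nu>"
            using exp_ge_add_one_self[of \<nu>] by (intro mult_left_mono) (linarith, simp)
          also have "\<dots> = exp (b * c0)" using \<open>b > 0\<close> by (simp add: c0_def algebra_simps flip: exp_add)
          finally show ?thesis .
        next
          case True
          define v where "v = real i - c"
          have v: "v0 \<le> v" "0 \<le> v" using True v0(1)[of v0] by (auto simp: v_def)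
          show ?thesis
          proof (rule ccontr)
            assume "\<not> a i \<le> exp (b * c0)"
            then have "exp (b * c0) \<le> a i" by simp
            moreover have "c \<le> c0" using v0(1)[of v0] \<open>\<nu> \<ge> 0\<close> \<open>b > 0\<close> by (simp add: c0_def)
            then have "exp (b * c) \<le> exp (b * c0)" using \<open>b > 0\<close> by simp
            ultimately have "exp (b * c) \<le> a i" by (rule order_trans[rotated])
            \<comment> \<open>The conversion is applied with the negative value l = -c: a set that
              is too large at level i counts as a set for the smaller parameter v = i - c.\<close>
            then have "exp (-(b * (-c))) \<le> a i" by simp
            from a_le[OF this] have big: "ennreal (exp (-(b * v))) \<le> emeasure N (E i)" by (simp add: v_def)
            from key[OF f f0 norm v(2) v0(2)[OF v(1), unfolded \<mu>_def]]
            obtain m where m: "0 \<le> m" "m \<le> 1"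
              and est: "\<And>v2 w E. v \<le> v2 \<Longrightarrow> 0 \<le> w \<Longrightarrow> E \<in> sets N \<Longrightarrow>
                ennreal (exp (-(b * v2))) \<le> emeasure N E \<Longrightarrow>
                (\<forall>x\<in>E. ennreal w \<le> (\<integral>\<^sup>+y. ennreal (k x y * f y) \<partial>M)) \<Longrightarrow>
                w \<le> (A * v + C) powr (1/\<beta>) * (1 - m) powr (1/p) + C * (v2 - v + 1) powr (1/\<beta>) * m powr (1/p)"
              unfolding b_def by blast
            have Av: "A * v + C > 0" using A_pos v C by (simp add: add_nonneg_pos)
            have "(A * real i) powr (1/\<beta>) \<le> (A * v + C) powr (1/\<beta>) * (1 - m) powr (1/p) + C * m powr (1/p)"
              using est[OF order_refl _ E big UE] by simp
            \<comment> \<open>The two factors that contain m have p-th powers 1 - m and m with sum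
              1, so Hoelder removes the unknown mass.\<close>
            also have "\<dots> \<le> (((A * v + C) powr (1/\<beta>)) powr \<beta> + C powr \<beta>) powr (1/\<beta>)
                * (((1 - m) powr (1/p)) powr p + (m powr (1/p)) powr p) powr (1/p)"
              using p beta C by (intro Holder_two) auto
            also have "\<dots> = (A * v + C + C powr \<beta>) powr (1/\<beta>)"
              using Av m p(1) beta by (simp add: powr_powr)
            also have "A * v + C + C powr \<beta> = A * (real i - 1)"
              using A_pos by (simp add: v_def c_def field_simps)
            finally have *: "(A * real i) powr (1/\<beta>) \<le> (A * (real i - 1)) powr (1/\<beta>)" .
            have "0 < A * (real i - 1)"
              using Av C \<open>A * v + C + C powr \<beta> = A * (real i - 1)\<close> by (smt (verit) powr_ge_zero)
            then have "(A * (real i - 1)) powr (1/\<beta>) < (A * real i) powr (1/\<beta>)"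
              using A_pos beta by (intro powr_less_mono2) auto
            then show False using * by simp
          qed
        qed
      next
        fix l n1 n2
        assume l: "1 \<le> l" and n12: "n1 \<le> n2" "K * l \<le> real n1"
          and a1: "exp (-(b * l)) \<le> a n1" and a2: "exp (-(b * l)) \<le> a n2"
        \<comment> \<open>\<open>K\<close> includes \<open>v0\<close> in its maximum in order that
          n1 + l is an admissible splitting parameter.\<close>
        have "K \<le> K * l" using K l by simp
        then have v1: "v0 \<le> real n1 + l" "0 \<le> real n1 + l" using n12 K l by linarith+
        have "K0 * l \<le> K * l" using K l by (intro mult_right_mono) auto
        then have K0l: "K0 * l \<le> real n1" using n12 by linarith
        from key[OF f f0 norm v1(2) v0(2)[OF v1(1), unfolded \<mu>_def]]
        obtain m where m: "0 \<le> m" "m \<le> 1"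
          and est: "\<And>v2 w E. real n1 + l \<le> v2 \<Longrightarrow> 0 \<le> w \<Longrightarrow> E \<in> sets N \<Longrightarrow>
            ennreal (exp (-(b * v2))) \<le> emeasure N E \<Longrightarrow>
            (\<forall>x\<in>E. ennreal w \<le> (\<integral>\<^sup>+y. ennreal (k x y * f y) \<partial>M)) \<Longrightarrow>
            w \<le> (A * (real n1 + l) + C) powr (1/\<beta>) * (1 - m) powr (1/p) + C * (v2 - (real n1 + l) + 1) powr (1/\<beta>) * m powr (1/p)"
          unfolding b_def by blast
        \<comment> \<open>With v2 = i + l and v1 = n1 + l the shift l cancels in v2 - v1. For i = n1
          the factor (i - n1 + 1)^(1/\<beta>) is 1, which gives the first premise of
          \<open>gap_estimate\<close>; i = n2 gives the second.\<close>
        have est': "real i powr (1/\<beta>) \<le> (real n1 + l + C / A) powr (1/\<beta>) * (1 - m) powr (1/p) + C' * (real i - real n1 + 1) powr (1/\<beta>) * m powr (1/p)"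
          if "n1 \<le> i" "exp (-(b * l)) \<le> a i" for i
        proof -
          have "(A * real i) powr (1/\<beta>) \<le> (A * (real n1 + l) + C) powr (1/\<beta>) * (1 - m) powr (1/p)
              + C * ((real i + l) - (real n1 + l) + 1) powr (1/\<beta>) * m powr (1/p)"
            using that by (intro est[OF _ _ E a_le UE]) auto
          also have "A * (real n1 + l) + C = A * (real n1 + l + C / A)" using A_pos by (simp add: field_simps)
          also have "\<dots> powr (1/\<beta>) = A powr (1/\<beta>) * (real n1 + l + C / A) powr (1/\<beta>)"
            using A_pos C' v1 by (intro powr_mult)
          also have "C * ((real i + l) - (real n1 + l) + 1) powr (1/\<beta>)
              = A powr (1/\<beta>) * (C' * (real i - real n1 + 1) powr (1/\<beta>))"
            using Apow by (simp add: C'_def)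
          finally have "A powr (1/\<beta>) * real i powr (1/\<beta>) \<le> A powr (1/\<beta>) * ((real n1 + l + C / A) powr (1/\<beta>) * (1 - m) powr (1/p)
              + C' * (real i - real n1 + 1) powr (1/\<beta>) * m powr (1/p))"
            unfolding Epow by (simp add: algebra_simps)
          then show ?thesis using Apow by (subst (asm) mult_le_cancel_left_pos) auto
        qed
        have "real n2 - real n1 \<le> K0 * l"
          using est'[OF order_refl a1] est'[OF n12(1) a2] l m n12 K0l by (intro gap) simp_all
        then show "real n2 - real n1 \<le> K * l" using \<open>K0 * l \<le> K * l\<close> by simp
      qed
      then show "(\<Sum>i<n. exp (\<beta>0 / \<beta> * real i) * measure N {x\<in>space N. U x powr \<beta> / A > real i}) \<le> S"
        by (simp add: a_def b_def E_def)
    qed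
  qed
qed


section \<open>Convergence almost everywhere and the exponential integral\<close>

text \<open>Cut k at 1. Below the cut k f \<le> f, and f is integrable because f \<le> 1 + f^p on a
  finite measure space. Above it, the averaged Schur bound makes the inner integral finite for
  almost every x, and the pointwise bound applies there.\<close>

lemma kernel_finite_AE:
  assumes [measurable]: "f \<in> borel_measurable M" and nonneg: "\<And>y. 0 \<le> f y"
    and norm: "(\<integral>\<^sup>+y. ennreal (f y powr p) \<partial>M) < \<infinity>"
  shows "AE x in N. (\<integral>\<^sup>+y. ennreal (k x y * f y) \<partial>M) < \<infinity>"
proof (rule tail_pointwise)
  fix a c :: real
  assume pw: "\<And>x \<sigma> h Y. \<lbrakk>x \<in> space N; 1 \<le> \<sigma>; h \<in> borel_measurable M; \<And>y. 0 \<le> h y; 0 \<le> Y;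
      (\<integral>\<^sup>+y. ennreal (k x y powr (a * p) * h y powr p) * indicator {y. k x y > \<sigma>} y \<partial>M) \<le> ennreal Y\<rbrakk> \<Longrightarrow>
      (\<integral>\<^sup>+y. ennreal (k x y * h y) * indicator {y. k x y > \<sigma>} y \<partial>M) \<le> ennreal (c * \<sigma> powr (-a) * Y powr (1/p))"
  assume int: "\<And>\<sigma> h. \<lbrakk>1 \<le> \<sigma>; h \<in> borel_measurable M\<rbrakk> \<Longrightarrow>
      (\<integral>\<^sup>+x. (\<integral>\<^sup>+y. ennreal (k x y powr (a * p) * h y powr p) * indicator {y. k x y > \<sigma>} y \<partial>M) \<partial>N)
      \<le> ennreal (c * \<sigma> powr (a * p - \<beta>0)) * (\<integral>\<^sup>+y. ennreal (h y powr p) \<partial>M)"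
  define J where "J x = (\<integral>\<^sup>+y. ennreal (k x y powr (a * p) * f y powr p) * indicator {y. k x y > 1} y \<partial>M)" for x
  have [measurable]: "J \<in> borel_measurable N" unfolding J_def indicator_def by measurable
  have "(\<integral>\<^sup>+x. J x \<partial>N) \<le> ennreal (c * 1 powr (a * p - \<beta>0)) * (\<integral>\<^sup>+y. ennreal (f y powr p) \<partial>M)"
    unfolding J_def by (rule int) auto
  also have "\<dots> < \<infinity>" using norm by (simp add: ennreal_mult_less_top)
  finally have J_fin: "AE x in N. J x \<noteq> \<infinity>" by (intro nn_integral_noteq_infinite) auto
  have f_fin: "(\<integral>\<^sup>+y. ennreal (f y) \<partial>M) < \<infinity>"
  proof -
    have "(\<integral>\<^sup>+y. ennreal (f y) \<partial>M) \<le> (\<integral>\<^sup>+y. 1 + ennreal (f y powr p) \<partial>M)"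
    proof (intro nn_integral_mono)
      fix y
      have "f y \<le> 1 + f y powr p"
        using nonneg[of y] p(1) powr_mono[of 1 p "f y"] by (cases "f y \<le> 1") (auto intro: add_increasing2)
      then have "ennreal (f y) \<le> ennreal (1 + f y powr p)" by (rule ennreal_leI)
      then show "ennreal (f y) \<le> 1 + ennreal (f y powr p)" by (simp add: ennreal_plus)
    qed
    also have "\<dots> = emeasure M (space M) + (\<integral>\<^sup>+y. ennreal (f y powr p) \<partial>M)" by (subst nn_integral_add) auto
    also have "\<dots> < \<infinity>" using norm by (simp add: M.emeasure_eq_measure)
    finally show ?thesis .
  qed
  show ?thesis
  proof (rule AE_mp[OF J_fin AE_I2], intro impI)
    fix x assume x[measurable]: "x \<in> space N" and "J x \<noteq> \<infinity>"
    then obtain Y where Y: "0 \<le> Y" "J x = ennreal Y" by (cases "J x") auto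
    have "(\<integral>\<^sup>+y. ennreal (k x y * f y) \<partial>M)
      \<le> (\<integral>\<^sup>+y. ennreal (f y) + ennreal (k x y * f y) * indicator {y. k x y > 1} y \<partial>M)"
      using nonneg k_nonneg
      by (intro nn_integral_mono) (auto simp: indicator_def intro!: ennreal_leI mult_left_le_one_le)
    also have "\<dots> = (\<integral>\<^sup>+y. ennreal (f y) \<partial>M) + (\<integral>\<^sup>+y. ennreal (k x y * f y) * indicator {y. k x y > 1} y \<partial>M)"
      by (rule nn_integral_add) measurable
    also have "\<dots> \<le> (\<integral>\<^sup>+y. ennreal (f y) \<partial>M) + ennreal (c * 1 powr (-a) * Y powr (1/p))"
      using Y nonneg x by (intro add_left_mono pw) (auto simp: J_def)
    also have "\<dots> < \<infinity>" using f_fin by simp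
    finally show "(\<integral>\<^sup>+y. ennreal (k x y * f y) \<partial>M) < \<infinity>" .
  qed
qed

lemma exponential_integrability:
  obtains C where "C \<ge> 0"
    "\<And>f U. \<lbrakk>f \<in> borel_measurable M; \<And>y. 0 \<le> f y; (\<integral>\<^sup>+y. ennreal (f y powr p) \<partial>M) \<le> 1;
      U \<in> borel_measurable N; \<And>x. 0 \<le> U x; \<And>x. x \<in> space N \<Longrightarrow> ennreal (U x) \<le> (\<integral>\<^sup>+y. ennreal (k x y * f y) \<partial>M)\<rbrakk> \<Longrightarrow>
      (\<integral>\<^sup>+x. ennreal (exp (\<beta>0 / (A * \<beta>) * U x powr \<beta>)) \<partial>N) \<le> ennreal C"
proof (rule exp_sum_bound)
  fix S :: real assume S: "S \<ge> 0"
  assume sum: "\<And>f U n. \<lbrakk>f \<in> borel_measurable M; \<And>y. 0 \<le> f y; (\<integral>\<^sup>+y. ennreal (f y powr p) \<partial>M) \<le> 1;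
      U \<in> borel_measurable N; \<And>x. 0 \<le> U x; \<And>x. x \<in> space N \<Longrightarrow> ennreal (U x) \<le> (\<integral>\<^sup>+y. ennreal (k x y * f y) \<partial>M)\<rbrakk> \<Longrightarrow>
      (\<Sum>i<n. exp (\<beta>0 / \<beta> * real i) * measure N {x\<in>space N. U x powr \<beta> / A > real i}) \<le> S"
  define b where "b = \<beta>0 / \<beta>"
  have "b > 0" using beta beta0 by (simp add: b_def)
  show thesis
  proof (rule that)
    show "exp b * (measure N (space N) + S) \<ge> 0" using S by simp
    fix f :: "'a \<Rightarrow> real" and U
    assume f: "f \<in> borel_measurable M" "\<And>y. 0 \<le> f y" "(\<integral>\<^sup>+y. ennreal (f y powr p) \<partial>M) \<le> 1"
      and U[measurable]: "U \<in> borel_measurable N" and U': "\<And>x. (0::real) \<le> U x"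
         "\<And>x. x \<in> space N \<Longrightarrow> ennreal (U x) \<le> (\<integral>\<^sup>+y. ennreal (k x y * f y) \<partial>M)"
    define W where "W x = U x powr \<beta> / A" for x
    have W0: "0 \<le> W x" for x using A_pos by (simp add: W_def)
    have [measurable]: "W \<in> borel_measurable N" unfolding W_def by measurable
    define a where "a i = exp (b * real i) * measure N {x\<in>space N. W x > real i}" for i
    have pw: "ennreal (exp (b * W x)) \<le> ennreal (exp b) *
        (1 + (\<Sum>i. ennreal (exp (b * real i)) * indicator {x\<in>space N. W x > real i} x))"
      if "x \<in> space N" for x
    proof (cases "W x = 0")
      case True
      have "ennreal (exp (b * W x)) \<le> ennreal (exp b) * 1" using True \<open>b > 0\<close> by simp
      also have "\<dots> \<le> ennreal (exp b) * (1 + (\<Sum>i. ennreal (exp (b * real i)) * indicator {x\<in>space N. W x > real i} x))"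
        by (intro mult_left_mono) auto
      finally show ?thesis .
    next
      case False
      \<comment> \<open>The level sets are strict, so W lies in (i, i + 1] for this i, and a single
        term of the series already dominates. The value W = 0 lies in no such interval and is
        covered by the summand 1.\<close>
      define i where "i = nat (\<lceil>W x\<rceil> - 1)"
      have i: "real i < W x" "W x \<le> real i + 1"
        using False W0[of x] unfolding i_def by linarith+
      have "exp (b * W x) \<le> exp (b * (real i + 1))" using i \<open>b > 0\<close> by simp
      then have "ennreal (exp (b * W x)) \<le> ennreal (exp b * exp (b * real i))"
        by (intro ennreal_leI) (simp add: algebra_simps exp_add)
      also have "\<dots> = ennreal (exp b) * (\<Sum>i\<in>{i}. ennreal (exp (b * real i)) * indicator {x\<in>space N. W x > real i} x)"
        using i that by (simp add: ennreal_mult)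
      also have "\<dots> \<le> ennreal (exp b) * (\<Sum>i. ennreal (exp (b * real i)) * indicator {x\<in>space N. W x > real i} x)"
        by (intro mult_left_mono sum_le_suminf) auto
      also have "\<dots> \<le> ennreal (exp b) * (1 + (\<Sum>i. ennreal (exp (b * real i)) * indicator {x\<in>space N. W x > real i} x))"
        by (intro mult_left_mono) (auto simp: add_increasing)
      finally show ?thesis .
    qed
    have "(\<integral>\<^sup>+x. ennreal (exp (b * W x)) \<partial>N) \<le> (\<integral>\<^sup>+x. ennreal (exp b) *
        (1 + (\<Sum>i. ennreal (exp (b * real i)) * indicator {x\<in>space N. W x > real i} x)) \<partial>N)"
      by (intro nn_integral_mono pw)
    also have "\<dots> = ennreal (exp b) * (emeasure N (space N) + (\<Sum>i. ennreal (exp (b * real i)) * emeasure N {x\<in>space N. W x > real i}))"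
      by (simp add: nn_integral_cmult nn_integral_add nn_integral_suminf)
    also have "\<dots> = ennreal (exp b) * (ennreal (measure N (space N)) + (\<Sum>i. ennreal (a i)))"
      by (simp add: N.emeasure_eq_measure a_def ennreal_mult)
    also have "\<dots> \<le> ennreal (exp b) * (ennreal (measure N (space N)) + ennreal S)"
    proof (intro mult_left_mono add_left_mono suminf_le_const)
      fix n
      have "(\<Sum>i<n. a i) \<le> S" unfolding a_def W_def b_def by (rule sum[OF f U U'])
      then have "ennreal (\<Sum>i<n. a i) \<le> ennreal S" by (rule ennreal_leI)
      then show "(\<Sum>i<n. ennreal (a i)) \<le> ennreal S" by (subst sum_ennreal) (auto simp: a_def)
    qed auto
    also have "\<dots> = ennreal (exp b * (measure N (space N) + S))"
      using S by (simp add: ennreal_mult ennreal_plus)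
    finally show "(\<integral>\<^sup>+x. ennreal (exp (\<beta>0 / (A * \<beta>) * U x powr \<beta>)) \<partial>N) \<le> ennreal (exp b * (measure N (space N) + S))"
      by (simp add: W_def b_def mult.commute)
  qed
qed

end

subsection \<open>Rearrangements\<close>

lemma distr_fun_antimono:
  assumes "s \<le> t" "{y\<in>space Q. \<bar>h y\<bar> > ereal s} \<in> sets Q"
  shows "distr_fun Q h t \<le> distr_fun Q h s"
  unfolding distr_fun_def using assms(2)
proof (intro emeasure_mono subsetI; simp)
  fix y assume "y \<in> space Q \<and> ereal t < \<bar>h y\<bar>"
  then show "ereal s < \<bar>h y\<bar>" using assms(1) by (meson ereal_less_eq(3) le_less_trans)
qed

text \<open>The strict inequality rests on the right continuity of the distribution function.\<close>

lemma less_rearr: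
  assumes meas: "\<And>s. {y\<in>space Q. \<bar>h y\<bar> > ereal s} \<in> sets Q"
    and less: "ennreal t < distr_fun Q h s"
  shows "ereal s < rearr Q h t"
proof -
  have "distr_fun Q h s = (SUP n::nat. emeasure Q {y\<in>space Q. \<bar>h y\<bar> > ereal (s + 1 / (real n + 1))})"
  proof (subst SUP_emeasure_incseq)
    show "incseq (\<lambda>n::nat. {y\<in>space Q. \<bar>h y\<bar> > ereal (s + 1 / (real n + 1))})"
    proof (intro monoI subsetI; simp)
      fix m n :: nat and y assume "m \<le> n" "y \<in> space Q \<and> ereal (s + 1 / (real m + 1)) < \<bar>h y\<bar>"
      moreover have "ereal (s + 1 / (real n + 1)) \<le> ereal (s + 1 / (real m + 1))"
        using \<open>m \<le> n\<close> by (auto intro: frac_le)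
      ultimately show "ereal (s + 1 / (real n + 1)) < \<bar>h y\<bar>" by (meson le_less_trans)
    qed
    have "ereal s < e \<longleftrightarrow> (\<exists>n::nat. ereal (s + 1 / (real n + 1)) < e)" for e
    proof
      assume "ereal s < e"
      then obtain r where r: "s < r" "ereal r \<le> e" by (metis ereal_dense2 less_imp_le less_ereal.simps(1))
      then obtain n where "inverse (real (Suc n)) < r - s" using reals_Archimedean[of "r - s"] by auto
      then have "ereal (s + 1 / (real n + 1)) < ereal r" by (simp add: inverse_eq_divide add_ac)
      then show "\<exists>n::nat. ereal (s + 1 / (real n + 1)) < e" using r by (meson less_le_trans)
    next
      assume "\<exists>n::nat. ereal (s + 1 / (real n + 1)) < e"
      then obtain n :: nat where "ereal (s + 1 / (real n + 1)) < e" by auto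
      moreover have "ereal s \<le> ereal (s + 1 / (real n + 1))" by simp
      ultimately show "ereal s < e" by (meson le_less_trans)
    qed
    then have "{y\<in>space Q. \<bar>h y\<bar> > ereal s} = (\<Union>n::nat. {y\<in>space Q. \<bar>h y\<bar> > ereal (s + 1 / (real n + 1))})" by auto
    then show "distr_fun Q h s = emeasure Q (\<Union>n::nat. {y\<in>space Q. \<bar>h y\<bar> > ereal (s + 1 / (real n + 1))})"
      by (simp add: distr_fun_def)
  qed (use meas in auto)
  then obtain n :: nat where n: "ennreal t < distr_fun Q h (s + 1 / (real n + 1))"
    using less by (auto simp: less_SUP_iff distr_fun_def)
  have "ereal (s + 1 / (real n + 1)) \<le> rearr Q h t"
    unfolding rearr_def
  proof (intro Inf_greatest)
    fix e assume "e \<in> {ereal s | s. 0 \<le> s \<and> distr_fun Q h s \<le> ennreal t}"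
    then obtain s' where s': "e = ereal s'" "distr_fun Q h s' \<le> ennreal t" by auto
    have "\<not> s' \<le> s + 1 / (real n + 1)"
    proof
      assume "s' \<le> s + 1 / (real n + 1)"
      from distr_fun_antimono[OF this meas] n s'(2) show False by (meson leD le_less_trans less_le_trans)
    qed
    then show "ereal (s + 1 / (real n + 1)) \<le> e" using s' by simp
  qed
  moreover have "ereal s < ereal (s + 1 / (real n + 1))" by simp
  ultimately show ?thesis by (meson less_le_trans)
qed

text \<open>A function has the same distribution function as its decreasing rearrangement, and the
  supremum over x only enlarges the superlevel set: with r the measure of {|h x| > s}, that set
  contains all of (0, r).\<close>

lemma distr_fun_le_line:
  assumes "finite_measure Q" "x \<in> X"
    and meas: "\<And>s. {y\<in>space Q. \<bar>h x y\<bar> > ereal s} \<in> sets Q"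
  shows "distr_fun Q (h x) s \<le> distr_fun_line (\<lambda>t. SUP x\<in>X. rearr Q (h x) t) s"
proof -
  interpret finite_measure Q by fact
  define g where "g t = (SUP x\<in>X. rearr Q (h x) t)" for t
  define S where "S = {t. 0 < t \<and> \<bar>g t\<bar> > ereal s}"
  have g_ge: "rearr Q (h x) t \<le> g t" for t unfolding g_def using \<open>x \<in> X\<close> by (intro SUP_upper)
  have g0: "0 \<le> g t" for t
  proof -
    have "0 \<le> rearr Q (h x) t" unfolding rearr_def by (intro Inf_greatest) auto
    then show ?thesis using g_ge order_trans by blast
  qed
  have g_anti: "g t' \<le> g t" if "t \<le> t'" for t t'
    unfolding g_def rearr_def
    using that by (intro SUP_mono bexI Inf_superset_mono) (auto elim!: order_trans intro: ennreal_leI)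
  \<comment> \<open>The supremum may run over uncountably many x, so measurability is not inherited
    from the rearrangements. It comes from monotonicity in t, which makes the superlevel set an
    interval; comparing its measure with that of (0, r) depends on this.\<close>
  have "is_interval S"
    unfolding is_interval_1 S_def using g0 g_anti by (auto simp: abs_ereal_ge0) (meson less_le_trans)
  then have [measurable]: "S \<in> sets borel" by (rule real_interval_borel_measurable)
  define r where "r = measure Q {y\<in>space Q. \<bar>h x y\<bar> > ereal s}"
  have r: "distr_fun Q (h x) s = ennreal r" by (simp add: distr_fun_def emeasure_eq_measure r_def)
  have "{0<..<r} \<subseteq> S"
  proof
    fix t assume t: "t \<in> {0<..<r}"
    then have "ennreal t < distr_fun Q (h x) s" unfolding r by (simp add: ennreal_less_iff)
    from less_rearr[OF meas this] g_ge[of t] have "ereal s < g t" by (meson less_le_trans)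
    then show "t \<in> S" using t g0 by (simp add: S_def abs_ereal_ge0)
  qed
  then have "emeasure lborel {0<..<r} \<le> emeasure lborel S" by (intro emeasure_mono) auto
  moreover have "r \<ge> 0" by (simp add: r_def)
  ultimately show ?thesis by (simp add: r distr_fun_line_def S_def g_def)
qed

text \<open>Infinite entries count as 0 here, exactly as in \<^const>\<open>kernel_dot\<close>.\<close>

definition finite_kernel_norm :: "ereal ^ 'n \<Rightarrow> real" where
  "finite_kernel_norm v = norm (\<chi> j. real_of_ereal (v $ j))"

lemma finite_kernel_norm_eq: "finite_kernel_norm v = sqrt (\<Sum>j\<in>UNIV. (real_of_ereal (v $ j))\<^sup>2)"
  by (simp only: finite_kernel_norm_def norm_vec_def L2_set_def real_norm_def vec_lambda_beta power2_abs)

text \<open>The two norms agree on vectors with finite entries; if some entry is infinite, the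
  right-hand side is \<infinity> and there is nothing to compare.\<close>

lemma finite_kernel_norm_less:
  assumes "s < finite_kernel_norm v"
  shows "ereal s < \<bar>ereal_vec_norm v\<bar>"
  using assms abs_ge_self[of "finite_kernel_norm v"]
  by (auto simp: ereal_vec_norm_def finite_kernel_norm_eq[symmetric])

lemma abs_kernel_dot_le: "\<bar>kernel_dot K F x y\<bar> \<le> finite_kernel_norm (K x y) * norm (F y)"
proof -
  have "kernel_dot K F x y = (\<chi> j. real_of_ereal (K x y $ j)) \<bullet> F y"
    by (simp add: kernel_dot_def inner_vec_def)
  then show ?thesis unfolding finite_kernel_norm_def by (metis Cauchy_Schwarz_ineq2)
qed

section \<open>The vector-valued operator\<close>

theorem theorem1:
  fixes M :: "'a measure" and N :: "'b measure"
    and K :: "'b \<Rightarrow> 'a \<Rightarrow> ereal ^ 'n"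
    and A B \<beta> \<gamma> \<beta>0 :: real
  assumes "finite_measure M" and "finite_measure N"
    and "\<And>j. (\<lambda>(x, y). K x y $ j) \<in> borel_measurable (N \<Otimes>\<^sub>M M)"
    and "A > 0" and "B > 0" and "\<beta> > 1" and "\<gamma> > 1" and "0 < \<beta>0" and "\<beta>0 \<le> \<beta>"
    and "\<exists>C0 s0. \<forall>s\<ge>s0. distr_fun_line (k1_star N M (\<lambda>x y. ereal_vec_norm (K x y))) s
            \<le> ennreal (A * s powr (-\<beta>) * (1 + C0 * (ln s) powr (-\<gamma>)))"
    and "\<exists>s1. \<forall>s\<ge>s1. distr_fun_line (k2_star N M (\<lambda>x y. ereal_vec_norm (K x y))) s
            \<le> ennreal (B * s powr (-\<beta>0))"
  shows "(\<forall>F::'a \<Rightarrow> real ^ 'n. in_Lp M (\<beta> / (\<beta> - 1)) F \<longrightarrow>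
            (AE x in N. integrable M (kernel_dot K F x)))
       \<and> (\<exists>C. \<forall>F::'a \<Rightarrow> real ^ 'n. in_Lp M (\<beta> / (\<beta> - 1)) F \<and> Lp_norm M (\<beta> / (\<beta> - 1)) F \<noteq> 0 \<longrightarrow>
            (\<integral>\<^sup>+ x. ennreal (exp ((\<beta>0 / (A * \<beta>)) *
                 (\<bar>T_op M K F x\<bar> / Lp_norm M (\<beta> / (\<beta> - 1)) F) powr \<beta>)) \<partial>N) \<le> ennreal C)"
proof -
  interpret M: finite_measure M by fact
  interpret N: finite_measure N by fact
  obtain C0 s0 where tail1: "\<And>s. s \<ge> s0 \<Longrightarrow> distr_fun_line (k1_star N M (\<lambda>x y. ereal_vec_norm (K x y))) s
            \<le> ennreal (A * s powr (-\<beta>) * (1 + C0 * (ln s) powr (-\<gamma>)))" using assms(10) by blast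
  obtain s1 where tail2: "\<And>s. s \<ge> s1 \<Longrightarrow> distr_fun_line (k2_star N M (\<lambda>x y. ereal_vec_norm (K x y))) s
            \<le> ennreal (B * s powr (-\<beta>0))" using assms(11) by blast
  have K_comp[measurable (raw)]: "(\<lambda>w. K (g w) (h w) $ j) \<in> borel_measurable L"
    if "g \<in> measurable L N" "h \<in> measurable L M" for g h j and L :: "'c measure"
    using measurable_compose[OF measurable_Pair[OF that] assms(3)[of j]] by simp
  define k where "k x y = finite_kernel_norm (K x y)" for x y
  have k_eq: "k x y = sqrt (\<Sum>j\<in>UNIV. (real_of_ereal (K x y $ j))\<^sup>2)" for x y
    by (simp add: k_def finite_kernel_norm_eq)
  have k_meas: "(\<lambda>(x, y). k x y) \<in> borel_measurable (N \<Otimes>\<^sub>M M)"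
    unfolding k_eq by measurable
  have dist1: "emeasure M {y\<in>space M. k x y > s} \<le> distr_fun_line (k1_star N M (\<lambda>x y. ereal_vec_norm (K x y))) s"
    if [measurable]: "x \<in> space N" for x s
  proof -
    have ms: "{y\<in>space M. \<bar>ereal_vec_norm (K x y)\<bar> > ereal s} \<in> sets M" for s
      unfolding ereal_vec_norm_def by measurable
    have "emeasure M {y\<in>space M. k x y > s} \<le> distr_fun M (\<lambda>y. ereal_vec_norm (K x y)) s"
      unfolding distr_fun_def k_def using ms by (intro emeasure_mono) (auto dest: finite_kernel_norm_less)
    also have "\<dots> \<le> distr_fun_line (k1_star N M (\<lambda>x y. ereal_vec_norm (K x y))) s"
      unfolding k1_star_def
      using distr_fun_le_line[where h = "\<lambda>x y. ereal_vec_norm (K x y)", OF M.finite_measure_axioms that ms] .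
    finally show ?thesis .
  qed
  have dist2: "emeasure N {x\<in>space N. k x y > s} \<le> distr_fun_line (k2_star N M (\<lambda>x y. ereal_vec_norm (K x y))) s"
    if [measurable]: "y \<in> space M" for y s
  proof -
    have ms: "{x\<in>space N. \<bar>ereal_vec_norm (K x y)\<bar> > ereal s} \<in> sets N" for s
      unfolding ereal_vec_norm_def by measurable
    have "emeasure N {x\<in>space N. k x y > s} \<le> distr_fun N (\<lambda>x. ereal_vec_norm (K x y)) s"
      unfolding distr_fun_def k_def using ms by (intro emeasure_mono) (auto dest: finite_kernel_norm_less)
    also have "\<dots> \<le> distr_fun_line (k2_star N M (\<lambda>x y. ereal_vec_norm (K x y))) s"
      unfolding k2_star_def
      using distr_fun_le_line[where h = "\<lambda>y x. ereal_vec_norm (K x y)", OF N.finite_measure_axioms that ms] .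
    finally show ?thesis .
  qed
  \<comment> \<open>A negative C0 may be replaced by 0, which only weakens the bound. The common
    threshold is raised to at least exp 1 for the sake of the logarithm.\<close>
  interpret adams_kernel M N k A B "max C0 0" "max (max s0 s1) (exp 1)" \<beta> \<gamma> \<beta>0
  proof unfold_locales
    show "(\<lambda>(x, y). k x y) \<in> borel_measurable (N \<Otimes>\<^sub>M M)" by (rule k_meas)
    show "0 \<le> k x y" for x y by (simp add: k_def finite_kernel_norm_def)
    fix x s assume "x \<in> space N" "max (max s0 s1) (exp 1) \<le> s"
    then have "emeasure M {y\<in>space M. k x y > s} \<le> ennreal (A * s powr (-\<beta>) * (1 + C0 * (ln s) powr (-\<gamma>)))"
      by (intro order_trans[OF dist1 tail1]) auto
    also have "\<dots> \<le> ennreal (A * s powr (-\<beta>) * (1 + max C0 0 * (ln s) powr (-\<gamma>)))"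
      using \<open>A > 0\<close> by (intro ennreal_leI mult_left_mono add_left_mono mult_right_mono) auto
    finally show "emeasure M {y\<in>space M. k x y > s} \<le> \<dots>" .
  next
    fix y s assume "y \<in> space M" "max (max s0 s1) (exp 1) \<le> s"
    then show "emeasure N {x\<in>space N. k x y > s} \<le> ennreal (B * s powr (-\<beta>0))"
      by (intro order_trans[OF dist2 tail2]) auto
  qed (use assms in auto)
  have dot_le: "ennreal \<bar>kernel_dot K F x y\<bar> \<le> ennreal (k x y * norm (F y))" for F x y
    unfolding k_def by (intro ennreal_leI abs_kernel_dot_le)
  have dot_meas: "(\<lambda>(x, y). kernel_dot K F x y) \<in> borel_measurable (N \<Otimes>\<^sub>M M)"
    if [measurable]: "F \<in> borel_measurable M" for F :: "'a \<Rightarrow> real ^ 'n"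
  proof -
    have [measurable]: "(\<lambda>y. F y $ j) \<in> borel_measurable M" for j
      by (rule measurable_compose[OF that borel_measurable_continuous_onI]) (intro continuous_intros)
    show ?thesis unfolding kernel_dot_def by measurable
  qed
  obtain C where C: "C \<ge> 0"
    and bound: "\<And>f U. \<lbrakk>f \<in> borel_measurable M; \<And>y. 0 \<le> f y; (\<integral>\<^sup>+y. ennreal (f y powr p) \<partial>M) \<le> 1;
      U \<in> borel_measurable N; \<And>x. 0 \<le> U x; \<And>x. x \<in> space N \<Longrightarrow> ennreal (U x) \<le> (\<integral>\<^sup>+y. ennreal (k x y * f y) \<partial>M)\<rbrakk> \<Longrightarrow>
      (\<integral>\<^sup>+x. ennreal (exp (\<beta>0 / (A * \<beta>) * U x powr \<beta>)) \<partial>N) \<le> ennreal C"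
    by (rule exponential_integrability) blast
  show ?thesis
    unfolding p_def[symmetric]
  proof (intro conjI exI[of _ C] allI impI)
    fix F :: "'a \<Rightarrow> real ^ 'n" assume F: "in_Lp M p F"
    then have [measurable]: "F \<in> borel_measurable M" by (simp add: in_Lp_def)
    have "AE x in N. (\<integral>\<^sup>+y. ennreal (k x y * norm (F y)) \<partial>M) < \<infinity>"
      using F by (intro kernel_finite_AE) (auto simp: in_Lp_def)
    then show "AE x in N. integrable M (kernel_dot K F x)"
    proof (rule AE_mp[OF _ AE_I2], intro impI)
      fix x assume x: "x \<in> space N" and fin: "(\<integral>\<^sup>+y. ennreal (k x y * norm (F y)) \<partial>M) < \<infinity>"
      have "kernel_dot K F x \<in> borel_measurable M"
        using measurable_compose[OF measurable_Pair1'[OF x] dot_meas[of F]] by simp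
      moreover have "(\<integral>\<^sup>+y. ennreal (norm (kernel_dot K F x y)) \<partial>M) < \<infinity>"
        using fin by (rule le_less_trans[rotated]) (auto intro!: nn_integral_mono dot_le)
      ultimately show "integrable M (kernel_dot K F x)" by (simp add: integrable_iff_bounded)
    qed
  next
    fix F :: "'a \<Rightarrow> real ^ 'n" assume "in_Lp M p F \<and> Lp_norm M p F \<noteq> 0"
    then have F: "in_Lp M p F" "Lp_norm M p F \<noteq> 0" by auto
    then have F_meas[measurable]: "F \<in> borel_measurable M" by (simp add: in_Lp_def)
    define L where "L = Lp_norm M p F"
    define I where "I = (\<integral>y. norm (F y) powr p \<partial>M)"
    have "L > 0" using F(2) by (simp add: L_def Lp_norm_def less_le)
    have "I \<ge> 0" by (simp add: I_def)
    have L: "L = I powr (1/p)" by (simp add: L_def I_def Lp_norm_def)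
    then have "I > 0" using \<open>L > 0\<close> \<open>I \<ge> 0\<close> by (cases "I = 0") auto
    have Lp: "L powr p = I" using L \<open>I > 0\<close> p(1) by (simp add: powr_powr)
    have int: "integrable M (\<lambda>y. norm (F y) powr p)"
      using F(1) by (simp add: in_Lp_def integrable_iff_bounded)
    have nn: "(\<integral>\<^sup>+y. ennreal (norm (F y) powr p) \<partial>M) = ennreal I"
      unfolding I_def using int by (intro nn_integral_eq_integral) auto
    show "(\<integral>\<^sup>+x. ennreal (exp (\<beta>0 / (A * \<beta>) * (\<bar>T_op M K F x\<bar> / Lp_norm M p F) powr \<beta>)) \<partial>N) \<le> ennreal C"
      unfolding L_def[symmetric]
    proof (rule bound)
      show "(\<lambda>y. norm (F y) / L) \<in> borel_measurable M" by measurable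
      show "0 \<le> norm (F y) / L" for y using \<open>L > 0\<close> by simp
      \<comment> \<open>The scalar bound is applied to |F| divided by its norm, whose p-th moment is
        at most one; correspondingly U is |TF| divided by the same number.\<close>
      have "(\<integral>\<^sup>+y. ennreal ((norm (F y) / L) powr p) \<partial>M) = (\<integral>\<^sup>+y. ennreal (1 / I) * ennreal (norm (F y) powr p) \<partial>M)"
        using \<open>L > 0\<close> \<open>I > 0\<close> by (intro nn_integral_cong) (simp add: powr_divide Lp flip: ennreal_mult)
      also have "\<dots> = ennreal (1 / I) * ennreal I" by (simp add: nn_integral_cmult nn)
      also have "\<dots> = 1" using \<open>I > 0\<close> by (simp flip: ennreal_mult)
      finally show "(\<integral>\<^sup>+y. ennreal ((norm (F y) / L) powr p) \<partial>M) \<le> 1" by simp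
      have "(\<lambda>x. T_op M K F x) \<in> borel_measurable N"
        unfolding T_op_def using dot_meas[OF F_meas] by (intro M.borel_measurable_lebesgue_integral) simp
      then show "(\<lambda>x. \<bar>T_op M K F x\<bar> / L) \<in> borel_measurable N" by measurable
      show "0 \<le> \<bar>T_op M K F x\<bar> / L" for x using \<open>L > 0\<close> by simp
      fix x assume [measurable]: "x \<in> space N"
      \<comment> \<open>The inequality holds at every x: where the integrand is not integrable, the
        integral is 0 by convention and the claim is trivial. No exceptional null set has to be
        removed.\<close>
      have "ennreal \<bar>T_op M K F x\<bar> \<le> (\<integral>\<^sup>+y. ennreal \<bar>kernel_dot K F x y\<bar> \<partial>M)"
      proof (cases "integrable M (kernel_dot K F x)")
        case True
        then show ?thesis
          using integral_norm_bound_ennreal[OF True] by (simp add: T_op_def)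
      next
        case False
        then show ?thesis by (simp add: T_op_def not_integrable_integral_eq)
      qed
      also have "\<dots> \<le> (\<integral>\<^sup>+y. ennreal (k x y * norm (F y)) \<partial>M)" by (intro nn_integral_mono dot_le)
      finally have "ennreal (1 / L) * ennreal \<bar>T_op M K F x\<bar> \<le> ennreal (1 / L) * (\<integral>\<^sup>+y. ennreal (k x y * norm (F y)) \<partial>M)"
        by (intro mult_left_mono) auto
      also have "\<dots> = (\<integral>\<^sup>+y. ennreal (1 / L) * ennreal (k x y * norm (F y)) \<partial>M)"
        by (rule nn_integral_cmult[symmetric]) measurable
      also have "\<dots> = (\<integral>\<^sup>+y. ennreal (k x y * (norm (F y) / L)) \<partial>M)"
        using \<open>L > 0\<close> k_nonneg by (intro nn_integral_cong) (simp flip: ennreal_mult)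
      finally show "ennreal (\<bar>T_op M K F x\<bar> / L) \<le> (\<integral>\<^sup>+y. ennreal (k x y * (norm (F y) / L)) \<partial>M)"
        using \<open>L > 0\<close> by (simp flip: ennreal_mult)
    qed
  qed
qed

end
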